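(* (a) Let $b$ be a one-component bounded function. Then there exists a constant $C=C(b)>0$ such that for every $a\in\mathbb{D}$, $$\sup_{z\in\mathbb{D}}\left|\frac{1-\overline{b(a)}b(z)}{1-\overline{a}z}\right|\le C\,\frac{1-|b(a)|^2}{1-|a|^2}.$$ (b) Let $b\in H^\infty(\mathbb{D})$ with $\|b\|_\infty=1$, and assume there is a constant $0<C<1$ such that $\mathrm{spec}(b)\subseteq\overline{\{z\in\mathbb{D}:|b(z)|\le C\}}$. If $$\sup_{z\in\mathbb{D}}\left|\frac{1-\overline{b(a)}b(z)}{1-\overline{a}z}\right|=o\!\left(\frac{1}{1-|a|^2}\right)\quad\text{as } |b(a)|\to1,$$ (that is, for every $\varepsilon>0$ there is $\delta>0$ such that the left side is at most $\varepsilon/(1-|a|^2)$ whenever $a\in\mathbb{D}$ and $|b(a)|>1-\delta$), then $b$ is one-component.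
   Context: $\mathbb{D}$ is the open unit disc and $H^\infty(\mathbb{D})$ the bounded analytic functions on $\mathbb{D}$, $\|b\|_\infty=\sup_{\mathbb{D}}|b|$. For $b\in H^\infty(\mathbb{D})$ with $\|b\|_\infty=1$, the spectrum of $b$ is $\mathrm{spec}(b)=\{\xi\in\partial\mathbb{D}: \liminf_{z\to\xi, z\in\mathbb{D}}|b(z)|<1\}$. Such a $b$ is called one-component (a one-component bounded function) if there is a constant $0<C<1$ such that (a) $\mathrm{spec}(b)\subseteq\overline{\{z\in\mathbb{D}:|b(z)|\le C\}}$ and (b) the set $\{z\in\mathbb{D}:|b(z)|<C\}$ is connected. *)

theory Defs
  imports "HOL-Analysis.Analysis"
begin

definition Hinf_unit :: "(complex \<Rightarrow> complex) \<Rightarrow> bool" where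
  "Hinf_unit b \<longleftrightarrow> b holomorphic_on ball 0 1 \<and> bounded (b ` ball 0 1)
      \<and> (SUP z\<in>ball 0 1. norm (b z)) = 1"

definition spec :: "(complex \<Rightarrow> complex) \<Rightarrow> complex set" where
  "spec b = {\<xi>. norm \<xi> = 1 \<and>
      Liminf (at \<xi> within ball 0 1) (\<lambda>z. ereal (norm (b z))) < 1}"

definition one_component :: "(complex \<Rightarrow> complex) \<Rightarrow> bool" where
  "one_component b \<longleftrightarrow> Hinf_unit b \<and> (\<exists>C::real. 0 < C \<and> C < 1 \<and>
      spec b \<subseteq> closure {z\<in>ball 0 1. norm (b z) \<le> C} \<and>
      connected {z\<in>ball 0 1. norm (b z) < C})"

end

theory Submission
  imports Defs "HOL-Complex_Analysis.Complex_Analysis"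
begin

text \<open>
  Let \<open>k\<^sub>a(z)\<close> be the quotient in the theorem and \<open>Q(z) = (1 - |b(z)|\<^sup>2) / (1 - |z|\<^sup>2)\<close>, so that the
  Schwarz-Pick lemma reads \<open>|k\<^sub>a(z)|\<^sup>2 \<le> Q(a) Q(z)\<close>.

  (a) If \<open>{|b| < C}\<close> is connected, then \<open>|b|\<^sup>2 \<le> C\<close> on every hyperbolic geodesic joining two of its
  points: after a disc automorphism the geodesic is a real segment around 0, a path in the set joins
  its ends, and together with its mirror image it winds around 0, so Cauchy's formula applied to
  high powers of \<open>b(z) cnj (b (cnj z))\<close> bounds the value at 0. Walking towards a fixed point
  of the set along such a geodesic and using Schwarz-Pick gives \<open>Q(a) \<ge> c / |1 - cnj a z|\<close> for
  all \<open>z\<close> in the set. Put \<open>R = c / Q(a)\<close>. If \<open>|1 - cnj a z|\<close> is at least a fixed multiple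
  of \<open>R\<close>, the bound \<open>|k\<^sub>a(z)| \<le> 2 / |1 - cnj a z|\<close> suffices. Otherwise \<open>|b| \<ge> C\<close>
  near \<open>z\<close> at scale \<open>R\<close> and \<open>|b| \<rightarrow> 1\<close> at the nearby boundary, so a barrier gives
  \<open>Q(z) \<lesssim> 1 / R\<close>, and Schwarz-Pick finishes.

  (b) The hypothesis with \<open>\<epsilon> = (1 - C) / 2\<close> forces \<open>|b| \<le> 1 - \<delta>\<close> on all radii ending in
  \<open>{|b| \<le> C}\<close> or in the spectrum. Let \<open>C'\<close> lie above \<open>C\<close> and \<open>1 - \<delta>\<close>.
  A component of \<open>{|b| < C'}\<close> not containing 0 avoids these radii, hence touches the circle in
  finitely many points only, and there the maximum principle for \<open>1 / b\<close> (with finitely many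
  exceptional points) yields \<open>|b| \<ge> C'\<close>, a contradiction.
\<close>

section \<open>Maximum principle with boundary limits\<close>

text \<open>If \<open>|h(v)| > M\<close>, the frontier condition keeps the set where
  \<open>|h|\<close> is at least \<open>|h(v)|\<close> from accumulating at the frontier of
  \<open>V\<close>. This set is then compact, so \<open>|h|\<close> attains its maximum over
  \<open>V\<close>. Phrasing the condition with \<open>eventually\<close> admits functions without
  boundary values.\<close>

lemma maximum_modulus_limsup:
  fixes h :: "complex \<Rightarrow> complex"
  assumes V: "open V" "connected V" "bounded V" and hol: "h holomorphic_on V"
    and bnd: "\<And>w s. \<lbrakk>w \<in> frontier V; s > M\<rbrakk> \<Longrightarrow> eventually (\<lambda>z. norm (h z) < s) (at w within V)"
    and v: "v \<in> V"
  shows "norm (h v) \<le> M"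
proof (rule ccontr)
  assume "\<not> norm (h v) \<le> M"
  define s where "s = norm (h v)"
  have s: "s > M"
    using \<open>\<not> norm (h v) \<le> M\<close> by (simp add: s_def)
  define S where "S = {z\<in>V. s \<le> norm (h z)}"
  have conth: "continuous_on V h"
    using hol holomorphic_on_imp_continuous_on by blast
  have "closed S"
    unfolding closed_limpt
  proof (intro allI impI)
    fix w assume w: "w islimpt S"
    have freq: "frequently (\<lambda>z. s \<le> norm (h z)) (at w within V)"
    proof -
      have "frequently (\<lambda>z. z \<in> S) (at w)"
        using w by (simp add: islimpt_conv_frequently_at)
      then show ?thesis
        unfolding frequently_def eventually_at_filter S_def
        by (auto elim!: eventually_mono contrapos_np)
    qed
    have "w \<in> closure V"
      using w unfolding S_def closure_def
      by (metis (no_types, lifting) UnI2 islimpt_subset mem_Collect_eq subsetI)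
    moreover have "w \<notin> frontier V"
      using bnd[of w s] s freq by (auto simp: frequently_def not_le)
    ultimately have "w \<in> V"
      using V(1) by (simp add: frontier_def interior_open)
    moreover have "s \<le> norm (h w)"
    proof (rule ccontr)
      assume "\<not> s \<le> norm (h w)"
      moreover have "((\<lambda>z. norm (h z)) \<longlongrightarrow> norm (h w)) (at w within V)"
        using conth \<open>w \<in> V\<close> by (intro tendsto_norm) (simp add: continuous_on_def)
      ultimately have "eventually (\<lambda>z. norm (h z) < s) (at w within V)"
        by (intro order_tendstoD) auto
      with freq show False
        by (auto simp: frequently_def not_le)
    qed
    ultimately show "w \<in> S"
      by (simp add: S_def)
  qed
  moreover have "bounded S"
    using V(3) by (rule bounded_subset) (auto simp: S_def)
  ultimately have "compact S"
    using compact_eq_bounded_closed by blast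
  moreover have "v \<in> S"
    using v by (simp add: S_def s_def)
  moreover have "continuous_on S (\<lambda>z. norm (h z))"
    using conth by (intro continuous_on_norm continuous_on_subset[OF conth]) (auto simp: S_def)
  ultimately obtain m where m: "m \<in> S" "\<And>z. z \<in> S \<Longrightarrow> norm (h z) \<le> norm (h m)"
    using continuous_attains_sup[of S "\<lambda>z. norm (h z)"] by blast
  have "norm (h z) \<le> norm (h m)" if "z \<in> V" for z
    using m that by (cases "z \<in> S") (auto simp: S_def)
  then have "h constant_on V"
    using maximum_modulus_principle[OF hol V(1,2) V(1) order_refl, of m] m by (auto simp: S_def)
  \<comment> \<open>A constant \<open>h\<close> makes the closed set \<open>S\<close> equal to the
    open set \<open>V\<close>, and a non-empty bounded subset of the plane is not clopen.\<close>
  then have "S = V"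
    using v by (auto simp: S_def s_def constant_on_def)
  then have "V = {} \<or> V = UNIV"
    using \<open>closed S\<close> V(1) clopen by blast
  then show False
    using v V(3) not_bounded_UNIV by auto
qed

section \<open>Moebius maps and the Schwarz-Pick lemma\<close>

lemma disc_one_minus_nonzero: "norm a < 1 \<Longrightarrow> norm z < 1 \<Longrightarrow> 1 - cnj a * z \<noteq> (0::complex)"
  by (metis complex_mod_cnj norm_mult_less eq_iff_diff_eq_0 less_irrefl mult_1 norm_one)

lemma one_minus_norm_le:
  fixes a z :: complex
  assumes "norm a \<le> 1" "norm z \<le> 1"
  shows "1 - norm a \<le> norm (1 - cnj a * z)" "1 - norm z \<le> norm (1 - cnj a * z)"
    and "norm (1 - cnj a * z) \<le> 2"
proof -
  have "norm (cnj a * z) \<le> norm a" "norm (cnj a * z) \<le> norm z" "norm (cnj a * z) \<le> 1"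
    using assms by (simp_all add: norm_mult mult_left_le mult_left_le_one_le mult_le_one)
  then show "1 - norm a \<le> norm (1 - cnj a * z)" "1 - norm z \<le> norm (1 - cnj a * z)"
      "norm (1 - cnj a * z) \<le> 2"
    using norm_triangle_ineq2[of 1 "cnj a * z"] norm_triangle_ineq4[of 1 "cnj a * z"] by auto
qed

lemma norm_one_minus_identity:
  "(norm (1 - cnj a * z))\<^sup>2 - (norm (z - a))\<^sup>2 = (1 - (norm a)\<^sup>2) * (1 - (norm z)\<^sup>2)"
  unfolding cmod_power2 by (simp add: algebra_simps power2_eq_square)

lemma one_minus_norm_Moebius:
  assumes "norm a < 1" "norm z < 1"
  shows "1 - (norm (Moebius_function 0 a z))\<^sup>2
    = (1 - (norm a)\<^sup>2) * (1 - (norm z)\<^sup>2) / (norm (1 - cnj a * z))\<^sup>2"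
  using disc_one_minus_nonzero[OF assms] norm_one_minus_identity[of a z]
  by (simp add: Moebius_function_simple norm_divide power_divide field_simps)

text \<open>The Schwarz lemma for \<open>g\<close>, which is \<open>f\<close> with both
  \<open>a\<close> and \<open>f a\<close> moved to 0, evaluated at
  \<open>Moebius_function 0 a z\<close>. Cleared of denominators, it is the inequality
  \<open>|k_a(z)|^2 <= Q(a) Q(z)\<close>.\<close>

lemma Schwarz_Pick:
  assumes hol: "f holomorphic_on ball 0 1" and lt: "\<And>z. norm z < 1 \<Longrightarrow> norm (f z) < 1"
    and a: "norm a < 1" and z: "norm z < 1"
  shows "(norm (1 - cnj (f a) * f z))\<^sup>2 * ((1 - (norm a)\<^sup>2) * (1 - (norm z)\<^sup>2))
    \<le> (1 - (norm (f a))\<^sup>2) * (1 - (norm (f z))\<^sup>2) * (norm (1 - cnj a * z))\<^sup>2"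
proof -
  define g where "g = Moebius_function 0 (f a) \<circ> f \<circ> Moebius_function 0 (- a)"
  have mp: "norm (Moebius_function 0 (-a) w) < 1" if "norm w < 1" for w
    using that a by (intro Moebius_function_norm_lt_1) auto
  have "g holomorphic_on ball 0 1"
    unfolding g_def o_assoc[symmetric]
    by (intro holomorphic_on_compose_gen[where t="ball 0 1"] Moebius_function_holomorphic hol)
       (use a lt mp in auto)
  moreover have "g 0 = 0"
    by (simp add: g_def Moebius_function_of_zero Moebius_function_eq_zero)
  moreover have "norm (g w) < 1" if "norm w < 1" for w
    unfolding g_def by (simp add: Moebius_function_norm_lt_1 a lt mp that)
  ultimately have "norm (g (Moebius_function 0 a z)) \<le> norm (Moebius_function 0 a z)"
    by (intro Schwarz_Lemma(1)) (use a z Moebius_function_norm_lt_1 in auto)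
  then have "norm (Moebius_function 0 (f a) (f z)) \<le> norm (Moebius_function 0 a z)"
    using a z by (simp add: g_def Moebius_function_compose)
  then have "1 - (norm (Moebius_function 0 a z))\<^sup>2 \<le> 1 - (norm (Moebius_function 0 (f a) (f z)))\<^sup>2"
    by (simp add: power_mono)
  then show ?thesis
    using disc_one_minus_nonzero[OF a z] disc_one_minus_nonzero[OF lt[OF a] lt[OF z]]
    by (simp add: one_minus_norm_Moebius a z lt field_simps)
qed

section \<open>Bounds along geodesics between points of a connected set\<close>

text \<open>Cauchy's formula for \<open>F^m\<close> along \<open>g\<close> bounds
  \<open>|F(0)|^m\<close> by a constant times \<open>C^m\<close>, and the constant is independent of
  \<open>m\<close>. So \<open>(|F(0)| / C)^m\<close> stays bounded as \<open>m\<close>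
  grows.\<close>

lemma Cauchy_powers_bound:
  assumes F: "F holomorphic_on ball 0 1" and g: "valid_path g" "pathfinish g = pathstart g"
    and S: "open S" "path_image g \<subseteq> S" "S \<subseteq> ball 0 1" "0 \<notin> path_image g"
    and C: "\<And>z. z \<in> S \<Longrightarrow> norm (F z) \<le> C" "0 < C" and w: "winding_number g 0 \<noteq> 0"
  shows "norm (F 0) \<le> C"
proof (rule ccontr)
  assume "\<not> norm (F 0) \<le> C"
  have "closed (path_image g)"
    using closed_valid_path_image g(1) by blast
  then obtain d where d: "d > 0" "cball 0 d \<subseteq> - path_image g"
    using S(4) open_contains_cball[of "- path_image g"] by auto
  \<comment> \<open>With a disc around 0 removed, \<open>T\<close> is still an open neighbourhood of
    the curve, and \<open>1 / z\<close> is bounded there by \<open>1 / d\<close>. The constant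
    \<open>L\<close> belonging to \<open>T\<close> serves all powers of \<open>F\<close> at
    once.\<close>
  define T where "T = S - cball 0 d"
  have T: "open T" "path_image g \<subseteq> T"
    using S d by (auto simp: T_def)
  obtain L where L: "L > 0"
    "\<And>f B. f holomorphic_on T \<Longrightarrow> (\<forall>z \<in> T. norm (f z) \<le> B) \<Longrightarrow> norm (contour_integral g f) \<le> L * B"
    using contour_integral_bound_exists[OF T(1) g(1) T(2)] by blast
  have nz: "z \<noteq> 0" "norm z \<ge> d" if "z \<in> T" for z
    using that d by (auto simp: T_def)
  define k where "k = norm (2 * pi * \<i> * winding_number g 0)"
  have k: "k > 0"
    using w by (simp add: k_def norm_mult)
  have bound: "k * (norm (F 0) / C) ^ m \<le> L / d" for m
  proof -
    have "((\<lambda>w. F w ^ m / (w - 0)) has_contour_integral (2*pi * \<i> * winding_number g 0 * F 0 ^ m)) g"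
      by (rule Cauchy_integral_formula_convex_simple[where S="ball 0 1"])
         (use g S F in \<open>auto intro!: holomorphic_intros\<close>)
    then have "contour_integral g (\<lambda>w. F w ^ m / w) = 2*pi * \<i> * winding_number g 0 * F 0 ^ m"
      using contour_integral_unique by fastforce
    moreover have "norm (contour_integral g (\<lambda>w. F w ^ m / w)) \<le> L * (C ^ m / d)"
    proof (rule L(2))
      show "(\<lambda>w. F w ^ m / w) holomorphic_on T"
        by (intro holomorphic_intros holomorphic_on_subset[OF F]) (use S nz in \<open>auto simp: T_def\<close>)
      show "\<forall>z\<in>T. norm (F z ^ m / z) \<le> C ^ m / d"
        using nz C d by (auto simp: norm_divide norm_power T_def intro!: frac_le power_mono)
    qed
    ultimately have "k * norm (F 0) ^ m \<le> L * (C ^ m / d)"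
      by (simp add: k_def norm_mult norm_power)
    then show ?thesis
      using C(2) d by (simp add: power_divide field_simps)
  qed
  have "1 < norm (F 0) / C"
    using \<open>\<not> norm (F 0) \<le> C\<close> C(2) by simp
  then obtain m where "L / d / k < (norm (F 0) / C) ^ m"
    using real_arch_pow by blast
  moreover have "(norm (F 0) / C) ^ m \<le> L / d / k"
    using bound[of m] by (simp only: pos_le_divide_eq[OF k] mult.commute)
  ultimately show False
    by linarith
qed

text \<open>A path in \<open>S\<close> from \<open>s\<close> to \<open>-t\<close>, continued by its
  mirror image run backwards, is a closed curve around 0. On \<open>S\<close> and its mirror image
  one factor of the product \<open>F\<close> is bounded by \<open>C\<close> and the other by 1,
  while \<open>F 0\<close> is \<open>|f(0)|^2\<close>.\<close>

lemma norm_center_le_of_opposite_points: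
  fixes f :: "complex \<Rightarrow> complex" and s t :: real
  assumes f: "f holomorphic_on ball 0 1" and le1: "\<And>z. norm z < 1 \<Longrightarrow> norm (f z) \<le> 1"
    and S: "open S" "connected S" "S \<subseteq> ball 0 1" and C: "\<And>z. z \<in> S \<Longrightarrow> norm (f z) \<le> C" "0 < C"
    and st: "s > 0" "t > 0" "of_real s \<in> S" "- of_real t \<in> S"
  shows "(norm (f 0))\<^sup>2 \<le> C"
proof (cases "0 \<in> S")
  case True
  then have "norm (f 0) \<le> C" "norm (f 0) \<le> 1"
    using C le1 by auto
  then show ?thesis
    using mult_mono[of "norm (f 0)" C "norm (f 0)" 1] C(2) by (simp add: power2_eq_square)
next
  case False
  define F where "F z = f z * cnj (f (cnj z))" for z
  obtain p where p: "polynomial_function p" "path_image p \<subseteq> S" "pathstart p = of_real s" "pathfinish p = - of_real t"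
    using connected_open_polynomial_connected[OF S(1,2) st(3,4)] by blast
  have vp: "valid_path p"
    using p(1) valid_path_polynomial_function by blast
  then have pp: "path p"
    by (rule valid_path_imp_path)
  have p0: "0 \<notin> path_image p"
    using p(2) False by auto
  define q where "q = cnj \<circ> p"
  have q: "valid_path q" "path q" "0 \<notin> path_image q" "path_image q = cnj ` path_image p"
      "pathfinish q = - of_real t" "pathstart q = of_real s"
    using vp p0 p(3,4) valid_path_imp_path[of q]
    by (auto simp: q_def valid_path_cnj path_image_compose pathstart_compose pathfinish_compose)
  define g where "g = p +++ reversepath q"
  define W where "W = winding_number p 0"
  \<comment> \<open>\<open>Re W\<close> counts the turns of \<open>p\<close> around 0. As
    \<open>p\<close> leads from the positive to the negative real axis,
    \<open>exp (2 pi i W)\<close> is negative, whereas \<open>Re W = 0\<close> would make it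
    positive.\<close>
  have "Re W \<noteq> 0"
  proof
    assume "Re W = 0"
    then have W: "W = \<i> * of_real (Im W)"
      by (simp add: complex_eq_iff)
    have "- of_real t = exp (2 * pi * \<i> * W) * of_real s"
      using winding_number_exp_2pi[OF pp p0] p(3,4) by (simp add: W_def)
    also have "2 * pi * \<i> * W = of_real (-2 * pi * Im W)"
      by (subst W) (simp add: algebra_simps)
    finally have "- of_real t = (of_real (exp (-2 * pi * Im W) * s) :: complex)"
      by (metis exp_of_real of_real_mult)
    then have "- t = exp (-2 * pi * Im W) * s"
      by (metis of_real_eq_iff of_real_minus)
    moreover have "exp (-2 * pi * Im W) * s > 0"
      using st by simp
    ultimately show False
      using st by linarith
  qed
  \<comment> \<open>Reflection turns \<open>W\<close> into \<open>- cnj W\<close> and reversal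
    changes the sign, so the total is twice \<open>Re W\<close>.\<close>
  have "winding_number g 0 = W + cnj W"
  proof -
    have "winding_number q 0 = - cnj W"
      using winding_number_cnj[OF pp p0] by (simp add: q_def W_def)
    moreover have "winding_number g 0 = W + - winding_number q 0"
      unfolding g_def using pp p0 q p
      by (subst winding_number_join) (simp_all add: winding_number_reversepath W_def)
    ultimately show ?thesis
      by simp
  qed
  then have "winding_number g 0 \<noteq> 0"
    using \<open>Re W \<noteq> 0\<close> by (simp add: complex_eq_iff)
  have cS: "open (cnj ` S)"
  proof -
    have "cnj ` S = cnj -` S"
      by (auto simp: image_iff) (metis complex_cnj_cnj)
    moreover have "open (cnj -` S)"
      using S(1) by (intro open_vimage continuous_intros) 
    ultimately show ?thesis
      by simp
  qed
  have "F holomorphic_on ball 0 1"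
  proof -
    have "(cnj \<circ> f \<circ> cnj) holomorphic_on (ball 0 1)"
    proof -
      have "cnj ` ball 0 1 = (ball 0 1 :: complex set)"
        by (auto simp: image_iff intro!: bexI[of _ "cnj _"])
      then show ?thesis
        using f holomorphic_on_compose_cnj_cnj[of f "ball 0 1"] by simp
    qed
    then show ?thesis
      unfolding F_def by (intro holomorphic_intros f) (simp add: o_def)
  qed
  have FC: "norm (F z) \<le> C" if z: "z \<in> S \<union> cnj ` S" for z
  proof -
    have n: "norm z < 1" "norm (cnj z) < 1"
      using z S(3) by auto
    consider "norm (f z) \<le> C" | "norm (f (cnj z)) \<le> C"
      using z C by auto
    then show ?thesis
      using le1[OF n(1)] le1[OF n(2)] C(2) mult_mono[of "norm (f z)" C "norm (f (cnj z))" 1]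
        mult_mono[of "norm (f z)" 1 "norm (f (cnj z))" C]
      by cases (auto simp: F_def norm_mult)
  qed
  have "norm (F 0) \<le> C"
  proof (rule Cauchy_powers_bound[of F g "S \<union> cnj ` S" C])
    show "path_image g \<subseteq> S \<union> cnj ` S" "0 \<notin> path_image g"
      using p q False by (auto simp: g_def path_image_join)
    show "valid_path g" "pathfinish g = pathstart g"
      using vp q p by (auto simp: g_def)
    show "S \<union> cnj ` S \<subseteq> ball 0 1"
      using S(3) by auto
    show "open (S \<union> cnj ` S)"
      using S(1) cS by blast
  qed fact+
  then show ?thesis
    by (simp add: F_def norm_mult power2_eq_square)
qed

text \<open>Multiplication by \<open>cnj w\<close> rotates the diameter through \<open>w\<close>
  onto the real axis.\<close>

lemma norm_center_le_of_opposite_points':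
  fixes f :: "complex \<Rightarrow> complex" and s t :: real
  assumes f: "f holomorphic_on ball 0 1" and le1: "\<And>z. norm z < 1 \<Longrightarrow> norm (f z) \<le> 1"
    and S: "open S" "connected S" "S \<subseteq> ball 0 1" and C: "\<And>z. z \<in> S \<Longrightarrow> norm (f z) \<le> C" "0 < C"
    and st: "s > 0" "t > 0" "of_real s * w \<in> S" "- of_real t * w \<in> S" and w: "norm w = 1"
  shows "(norm (f 0))\<^sup>2 \<le> C"
proof -
  have ww: "cnj w * w = 1" "w * cnj w = 1"
    using w complex_norm_square[of w] by (simp_all add: mult.commute)
  have "(norm ((f \<circ> (\<lambda>z. w * z)) 0))\<^sup>2 \<le> C"
  proof (rule norm_center_le_of_opposite_points[where S="(*) (cnj w) ` S" and s=s and t=t])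
    show "(f \<circ> (\<lambda>z. w * z)) holomorphic_on ball 0 1"
      by (intro holomorphic_on_compose_gen[OF _ f] holomorphic_intros) (auto simp: norm_mult w)
    show "open ((*) (cnj w) ` S)"
      using S(1) w by (intro open_times_image) auto
    show "connected ((*) (cnj w) ` S)"
      using S(2) by (intro connected_continuous_image continuous_intros)
    show "(*) (cnj w) ` S \<subseteq> ball 0 1"
      using S(3) w by (auto simp: norm_mult)
    show "norm ((f \<circ> (\<lambda>z. w * z)) z) \<le> C" if "z \<in> (*) (cnj w) ` S" for z
      using that C(1) ww by (auto simp: mult.assoc[symmetric])
    show "of_real s \<in> (*) (cnj w) ` S"
      using st(3) ww by (auto simp: image_iff intro!: bexI[of _ "of_real s * w"])
    show "- of_real t \<in> (*) (cnj w) ` S"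
      using st(4) ww by (auto simp: image_iff intro!: bexI[of _ "- of_real t * w"])
  qed (use st C le1 w in \<open>auto simp: norm_mult\<close>)
  then show ?thesis
    by simp
qed

lemma Moebius_image:
  assumes p: "norm p < 1" and S: "open S" "connected S" "S \<subseteq> ball 0 1"
  shows "open (Moebius_function 0 p ` S)" "connected (Moebius_function 0 p ` S)"
    "Moebius_function 0 p ` S \<subseteq> ball 0 1"
proof -
  have cont: "continuous_on (ball 0 1) (Moebius_function 0 q)" if "norm q < 1" for q
    using Moebius_function_holomorphic[OF that] holomorphic_on_imp_continuous_on by blast
  show "connected (Moebius_function 0 p ` S)"
    by (intro connected_continuous_image S continuous_on_subset[OF cont[OF p]])
  show sub: "Moebius_function 0 p ` S \<subseteq> ball 0 1"
    using S(3) Moebius_function_norm_lt_1[OF p] by auto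
  have "Moebius_function 0 p ` S = ball 0 1 \<inter> Moebius_function 0 (- p) -` S" (is "?L = ?R")
  proof
    show "?L \<subseteq> ?R"
      using sub S(3) p by (auto simp: Moebius_function_compose)
    show "?R \<subseteq> ?L"
    proof
      fix x assume "x \<in> ?R"
      then show "x \<in> ?L"
        using p Moebius_function_compose[of p "-p" x] by (auto simp: image_iff intro!: bexI[of _ "Moebius_function 0 (- p) x"])
    qed
  qed
  also have "open \<dots>"
    using cont[of "-p"] p S(1) by (intro continuous_open_preimage) auto
  finally show "open (Moebius_function 0 p ` S)" .
qed

lemma holomorphic_Moebius_compose:
  assumes "f holomorphic_on ball 0 1" "norm p < 1"
  shows "(f \<circ> Moebius_function 0 p) holomorphic_on ball 0 1"
  using assms Moebius_function_norm_lt_1[OF assms(2)]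
  by (intro holomorphic_on_compose_gen[OF Moebius_function_holomorphic]) auto

text \<open>The automorphism that takes \<open>p = t z\<close> to 0 sends 0 and \<open>z\<close> to
  opposite sides of the origin on one diameter, and both images lie in the connected image of
  \<open>S\<close>. The value at the centre is then \<open>f p\<close>.\<close>

lemma norm_radius_le_of_connected:
  fixes f :: "complex \<Rightarrow> complex" and t :: real
  assumes f: "f holomorphic_on ball 0 1" and le1: "\<And>z. norm z < 1 \<Longrightarrow> norm (f z) \<le> 1"
    and S: "open S" "connected S" "S \<subseteq> ball 0 1" and C: "\<And>z. z \<in> S \<Longrightarrow> norm (f z) \<le> C" "0 < C"
    and z: "0 \<in> S" "z \<in> S" and t: "0 \<le> t" "t \<le> 1"
  shows "(norm (f (of_real t * z)))\<^sup>2 \<le> C"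
proof (cases "t = 0 \<or> t = 1 \<or> z = 0")
  case True
  then have "of_real t * z \<in> S"
    using z by auto
  then have "norm (f (of_real t * z)) \<le> C" "norm (f (of_real t * z)) \<le> 1"
    using C le1 S(3) by auto
  then show ?thesis
    using mult_mono[of "norm (f (of_real t * z))" C "norm (f (of_real t * z))" 1] C(2)
    by (simp add: power2_eq_square)
next
  case False
  define p where "p = of_real t * z"
  \<comment> \<open>The sign is chosen so that the image \<open>- p\<close> of 0 is a positive
    multiple of \<open>w\<close>.\<close>
  define w where "w = - z / of_real (norm z)"
  have nz: "norm z < 1" "norm z > 0"
    using z(2) S(3) False by auto
  have p: "norm p < 1"
    unfolding p_def norm_mult using t nz mult_le_one[of t "norm z"]
    by (metis abs_of_nonneg mult_left_le_one_le norm_ge_zero norm_of_real order_le_less_trans)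
  have z_w: "z = - of_real (norm z) * w"
    using nz by (simp add: w_def)
  have pz: "cnj p * z = of_real (t * (norm z)\<^sup>2)"
    using complex_norm_square[of z] by (simp add: p_def mult.commute)
  have sq: "t * (norm z)\<^sup>2 < 1"
    using t nz by (smt (verit) mult_le_one power2_eq_square mult_left_le_one_le mult_mono power_less_one_iff zero_le_power2 pos2)
  have "(norm ((f \<circ> Moebius_function 0 (- p)) 0))\<^sup>2 \<le> C"
  proof (rule norm_center_le_of_opposite_points'[where S="Moebius_function 0 p ` S" and w=w
        and s="t * norm z" and t="(1 - t) * norm z / (1 - t * (norm z)\<^sup>2)"])
    show "(f \<circ> Moebius_function 0 (- p)) holomorphic_on ball 0 1"
      using f p by (intro holomorphic_Moebius_compose) auto
    show "norm ((f \<circ> Moebius_function 0 (- p)) x) \<le> 1" if "norm x < 1" for x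
      using that p le1 Moebius_function_norm_lt_1[of "-p" x] by simp
    show "norm ((f \<circ> Moebius_function 0 (- p)) x) \<le> C" if "x \<in> Moebius_function 0 p ` S" for x
      using that p S(3) C(1) by (auto simp: Moebius_function_compose)
    show "t * norm z > 0" "(1 - t) * norm z / (1 - t * (norm z)\<^sup>2) > 0"
      using False t nz sq by auto
    show "norm w = 1"
      using nz by (simp add: w_def norm_divide)
    have "Moebius_function 0 p 0 = of_real (t * norm z) * w"
      by (simp add: Moebius_function_of_zero p_def) (subst z_w, simp)
    then show "of_real (t * norm z) * w \<in> Moebius_function 0 p ` S"
      using z(1) by (metis imageI)
    have "Moebius_function 0 p z = (z - p) / (1 - of_real (t * (norm z)\<^sup>2))"
      by (simp only: Moebius_function_simple pz)
    also have "z - p = of_real (1 - t) * z"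
      by (simp add: p_def algebra_simps)
    also have "\<dots> = - of_real ((1 - t) * norm z) * w"
      by (subst z_w) simp
    finally have "Moebius_function 0 p z = - of_real ((1 - t) * norm z / (1 - t * (norm z)\<^sup>2)) * w"
      by simp
    then show "- of_real ((1 - t) * norm z / (1 - t * (norm z)\<^sup>2)) * w \<in> Moebius_function 0 p ` S"
      using z(2) by (metis imageI)
  qed (use Moebius_image[OF p S] C in auto)
  then show ?thesis
    by (simp add: Moebius_function_of_zero p_def)
qed

section \<open>Lower bound for \<open>Q(a)\<close> in terms of a connected sublevel set\<close>

text \<open>Schwarz-Pick is applied to \<open>a\<close> and a point \<open>p\<close> on the radius
  of \<open>z\<close>, not to \<open>z\<close> itself: \<open>1 - |p|\<close> is comparable to
  \<open>|1 - cnj a z|\<close>, and \<open>|f(p)|\<close> is still at most \<open>sqrt C\<close>.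
  The factor \<open>1 - |p|^2\<close> then cancels, which leaves a bound independent of the distance
  of \<open>z\<close> from the circle.\<close>

lemma level_set_estimate_0:
  assumes f: "f holomorphic_on ball 0 1" and lt1: "\<And>z. norm z < 1 \<Longrightarrow> norm (f z) < 1"
    and S: "open S" "connected S" "S \<subseteq> ball 0 1" and C: "\<And>z. z \<in> S \<Longrightarrow> norm (f z) \<le> C" "0 < C" "C < 1"
    and z: "0 \<in> S" "z \<in> S" and a: "norm a < 1"
  shows "(1 - sqrt C)\<^sup>2 / 4 * (1 - (norm a)\<^sup>2) \<le> (1 - (norm (f a))\<^sup>2) * norm (1 - cnj a * z)"
proof -
  define r where "r = norm (1 - cnj a * z)"
  have nz: "norm z < 1"
    using z S by auto
  have r: "1 - norm z \<le> r" "r > 0"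
    using one_minus_norm_le[of a z] a nz by (auto simp: r_def)
  \<comment> \<open>For \<open>r < 1\<close> the point is placed at distance \<open>r\<close> from
    the circle; then \<open>|1 - cnj a p| <= 2 r\<close>, and \<open>1 - (1 - r)^2 >= r\<close>. For
    \<open>r >= 1\<close> the origin serves.\<close>
  have "\<exists>t. 0 \<le> t \<and> t \<le> 1 \<and> (norm (1 - cnj a * (of_real t * z)))\<^sup>2 \<le> 4 * r * (1 - (norm (of_real t * z))\<^sup>2)"
  proof (cases "r \<ge> 1")
    case True
    then show ?thesis
      by (intro exI[of _ 0]) auto
  next
    case False
    then have "z \<noteq> 0" "norm z > 0"
      using r by auto
    define t where "t = (1 - r) / norm z"
    have t: "0 \<le> t" "t \<le> 1" "t * norm z = 1 - r"
      using False r \<open>norm z > 0\<close> by (auto simp: t_def field_simps)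
    have "1 - cnj a * (of_real t * z) = (1 - cnj a * z) + cnj a * (of_real (1 - t) * z)"
      by (simp add: algebra_simps)
    then have "norm (1 - cnj a * (of_real t * z)) \<le> r + norm (cnj a * (of_real (1 - t) * z))"
      unfolding r_def by (metis norm_triangle_ineq)
    also have "norm (cnj a * (of_real (1 - t) * z)) = norm a * (norm z - t * norm z)"
      using t by (simp add: norm_mult left_diff_distrib del: of_real_diff)
    also have "\<dots> \<le> 1 * r"
      using a t nz r by (intro mult_mono) (auto simp: mult_left_le_one_le)
    finally have "(norm (1 - cnj a * (of_real t * z)))\<^sup>2 \<le> (2 * r)\<^sup>2"
      by (intro power_mono) auto
    also have "\<dots> \<le> 4 * r * (1 - (1 - r)\<^sup>2)"
      using r(2) False by (auto simp: power2_eq_square algebra_simps)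
    also have "1 - r = norm (of_real t * z)"
      using t by (simp add: norm_mult)
    finally show ?thesis
      using t by blast
  qed
  then obtain t where t: "0 \<le> t" "t \<le> 1"
    "(norm (1 - cnj a * (of_real t * z)))\<^sup>2 \<le> 4 * r * (1 - (norm (of_real t * z))\<^sup>2)"
    by blast
  define p where "p = of_real t * z"
  have p: "norm p < 1"
    using t nz mult_left_le_one_le[of "norm z" t] by (auto simp: p_def norm_mult)
  have "(norm (f p))\<^sup>2 \<le> C"
    unfolding p_def using t lt1 by (intro norm_radius_le_of_connected[OF f _ S C(1,2) z]) (auto intro: less_imp_le)
  then have fp: "norm (f p) \<le> sqrt C"
    by (simp add: real_le_rsqrt)
  have sC: "sqrt C < 1"
    using C by simp
  have "1 - sqrt C \<le> norm (1 - cnj (f a) * f p)"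
    using one_minus_norm_le(2)[of "f a" "f p"] fp lt1[OF a] lt1[OF p] by simp
  then have "(1 - sqrt C)\<^sup>2 \<le> (norm (1 - cnj (f a) * f p))\<^sup>2"
    using sC by (intro power_mono) auto
  have P: "0 < 1 - (norm p)\<^sup>2" "0 < 1 - (norm a)\<^sup>2" "0 < 1 - (norm (f a))\<^sup>2" "1 - (norm (f p))\<^sup>2 \<le> 1"
    "0 \<le> 1 - (norm (f p))\<^sup>2"
    using p a lt1[OF a] lt1[OF p] by (auto simp: power_less_one_iff abs_square_le_1)
  have "(1 - sqrt C)\<^sup>2 * ((1 - (norm a)\<^sup>2) * (1 - (norm p)\<^sup>2))
    \<le> (norm (1 - cnj (f a) * f p))\<^sup>2 * ((1 - (norm a)\<^sup>2) * (1 - (norm p)\<^sup>2))"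
    using \<open>(1 - sqrt C)\<^sup>2 \<le> _\<close> P by (intro mult_right_mono) auto
  also have "\<dots> \<le> (1 - (norm (f a))\<^sup>2) * (1 - (norm (f p))\<^sup>2) * (norm (1 - cnj a * p))\<^sup>2"
    by (rule Schwarz_Pick[OF f lt1 a p])
  also have "\<dots> \<le> (1 - (norm (f a))\<^sup>2) * 1 * (4 * r * (1 - (norm p)\<^sup>2))"
    using t(3) P r(2) by (intro mult_mono) (auto simp: p_def)
  finally have "((1 - sqrt C)\<^sup>2 * (1 - (norm a)\<^sup>2)) * (1 - (norm p)\<^sup>2) \<le> ((1 - (norm (f a))\<^sup>2) * (4 * r)) * (1 - (norm p)\<^sup>2)"
    by (simp only: mult_1_right mult_ac)
  then have "(1 - sqrt C)\<^sup>2 * (1 - (norm a)\<^sup>2) \<le> (1 - (norm (f a))\<^sup>2) * (4 * r)"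
    using P(1) by simp
  then show ?thesis
    by (simp add: r_def)
qed

text \<open>The polarised form of \<open>one_minus_norm_Moebius\<close>, which is recovered for
  \<open>z = a\<close>.\<close>

lemma one_minus_cnj_Moebius:
  assumes "norm p < 1" "norm a < 1" "norm z < 1"
  shows "1 - cnj (Moebius_function 0 p a) * Moebius_function 0 p z
     = of_real (1 - (norm p)\<^sup>2) * (1 - cnj a * z) / (cnj (1 - cnj p * a) * (1 - cnj p * z))"
proof -
  have "cnj (1 - cnj p * a) \<noteq> 0" "1 - cnj p * z \<noteq> 0"
    using disc_one_minus_nonzero assms complex_cnj_zero_iff by blast+
  then show ?thesis
    using complex_norm_square[of p]
    by (simp add: Moebius_function_simple divide_simps) (simp add: algebra_simps)
qed

text \<open>Moving \<open>p\<close> to 0 reduces this to the preceding estimate. Changing back costs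
  the quotient of \<open>|1 - cnj p z| >= 1 - |p|\<close> by \<open>|1 - cnj p a| <= 2\<close>,
  hence the additional factor \<open>(1 - |p|) / 2\<close>.\<close>

lemma level_set_estimate:
  assumes f: "f holomorphic_on ball 0 1" and lt1: "\<And>z. norm z < 1 \<Longrightarrow> norm (f z) < 1"
    and S: "open S" "connected S" "S \<subseteq> ball 0 1" and C: "\<And>z. z \<in> S \<Longrightarrow> norm (f z) \<le> C" "0 < C" "C < 1"
    and z: "p \<in> S" "z \<in> S" and a: "norm a < 1"
  shows "(1 - norm p) * (1 - sqrt C)\<^sup>2 / 8 * (1 - (norm a)\<^sup>2)
    \<le> (1 - (norm (f a))\<^sup>2) * norm (1 - cnj a * z)"
proof -
  define \<phi> where "\<phi> = Moebius_function 0 p"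
  have nz: "norm z < 1" and p: "norm p < 1"
    using z S by auto
  have "(1 - sqrt C)\<^sup>2 / 4 * (1 - (norm (\<phi> a))\<^sup>2)
    \<le> (1 - (norm ((f \<circ> Moebius_function 0 (- p)) (\<phi> a)))\<^sup>2) * norm (1 - cnj (\<phi> a) * \<phi> z)"
  proof (rule level_set_estimate_0[where S="\<phi> ` S"])
    show "(f \<circ> Moebius_function 0 (- p)) holomorphic_on ball 0 1"
      using f p by (intro holomorphic_Moebius_compose) auto
    show "norm ((f \<circ> Moebius_function 0 (- p)) x) < 1" if "norm x < 1" for x
      using that p lt1 Moebius_function_norm_lt_1[of "-p" x] by simp
    show "norm ((f \<circ> Moebius_function 0 (- p)) x) \<le> C" if "x \<in> \<phi> ` S" for x
      using that p S(3) C(1) by (auto simp: \<phi>_def Moebius_function_compose)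
    show "0 \<in> \<phi> ` S"
      using z(1) Moebius_function_eq_zero[of 0 p] unfolding \<phi>_def by (metis imageI)
    show "norm (\<phi> a) < 1"
      using Moebius_function_norm_lt_1[OF p a] by (simp add: \<phi>_def)
  qed (use C z Moebius_image[OF p S] in \<open>auto simp: \<phi>_def\<close>)
  also have "(f \<circ> Moebius_function 0 (- p)) (\<phi> a) = f a"
    using p a by (simp add: \<phi>_def Moebius_function_compose)
  finally have *: "(1 - sqrt C)\<^sup>2 / 4 * ((1 - (norm p)\<^sup>2) * (1 - (norm a)\<^sup>2) / (norm (1 - cnj p * a))\<^sup>2)
    \<le> (1 - (norm (f a))\<^sup>2) * ((1 - (norm p)\<^sup>2) * norm (1 - cnj a * z) / (norm (1 - cnj p * a) * norm (1 - cnj p * z)))"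
    using p power_le_one[of "norm p" 2]
    by (simp add: \<phi>_def one_minus_norm_Moebius one_minus_cnj_Moebius a nz norm_divide norm_mult del: of_real_diff complex_cnj_diff complex_cnj_mult)
  define A where "A = norm (1 - cnj p * a)"
  define B where "B = norm (1 - cnj p * z)"
  have AB: "0 < A" "A \<le> 2" "0 < B" "1 - norm p \<le> B"
    using one_minus_norm_le[of p a] one_minus_norm_le[of p z] p a nz disc_one_minus_nonzero
    by (auto simp: A_def B_def)
  have P: "0 < 1 - (norm p)\<^sup>2" "0 \<le> 1 - (norm a)\<^sup>2"
    using p a by (auto simp: power_less_one_iff abs_square_le_1)
  define X where "X = (1 - sqrt C)\<^sup>2 / 4 * (1 - (norm a)\<^sup>2)"
  define Y where "Y = (1 - (norm (f a))\<^sup>2) * norm (1 - cnj a * z)"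
  define d where "d = 1 - (norm p)\<^sup>2"
  have "X * d / (A * A) \<le> Y * d / (A * B)"
    using * by (simp add: A_def B_def X_def Y_def d_def power2_eq_square mult_ac)
  moreover have "d > 0"
    using P by (simp add: d_def)
  ultimately have "X * B \<le> Y * A"
    using AB by (simp add: field_simps)
  moreover have "0 \<le> X"
    using P by (simp add: X_def)
  moreover have "0 \<le> Y"
    using lt1[OF a] by (simp add: Y_def abs_square_le_1)
  ultimately have "X * (1 - norm p) \<le> Y * 2"
    using AB by (meson mult_left_mono order_trans)
  then show ?thesis
    by (simp add: X_def Y_def mult_ac)
qed

section \<open>A barrier near the unit circle\<close>

text \<open>The maximum principle for \<open>exp (- \<kappa> P) / f\<close> on the part of the disc
  near \<open>\<zeta>\<close>. On the circle \<open>Re P >= 0\<close> and \<open>|f|\<close> tends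
  to at least 1; on the inner arc \<open>Re P >= 1\<close>, and \<open>exp (- \<kappa>) = C\<close>
  compensates for \<open>|f| >= C\<close>. Since \<open>P\<close> vanishes linearly at
  \<open>\<zeta>\<close>, the bound is linear in \<open>1 - t\<close>.\<close>

lemma barrier_bound:
  fixes f :: "complex \<Rightarrow> complex" and C \<rho> t :: real
  assumes f: "f holomorphic_on ball 0 1" and C: "0 < C" "C \<le> 1" and \<zeta>: "norm \<zeta> = 1" and \<rho>: "\<rho> > 0"
    and ge: "\<And>z. \<lbrakk>norm z < 1; norm (z - \<zeta>) < \<rho>\<rbrakk> \<Longrightarrow> C \<le> norm (f z)"
    and bd: "\<And>w s. \<lbrakk>norm w = 1; norm (w - \<zeta>) < \<rho>; s < 1\<rbrakk>
      \<Longrightarrow> eventually (\<lambda>z. s < norm (f z)) (at w within ball 0 1)"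
    and t: "0 \<le> t" "t < 1" "1 - t < \<rho>"
  shows "1 - 2 * ln (1 / C) * (1 - t) / \<rho> \<le> norm (f (of_real t * \<zeta>))"
proof -
  define \<kappa> where "\<kappa> = ln (1 / C)"
  have \<kappa>: "\<kappa> \<ge> 0" "exp \<kappa> = 1 / C"
    using C by (simp_all add: \<kappa>_def)
  have \<zeta>1: "cnj \<zeta> * \<zeta> = 1"
    using \<zeta> complex_norm_square[of \<zeta>] by (simp add: mult.commute)
  \<comment> \<open>With \<open>w = (1 - cnj \<zeta> z) / \<rho>\<close>, the linear function
    \<open>Re w\<close> alone can be small where the arc \<open>|w| = 1\<close> approaches the unit
    circle. Subtracting \<open>w^2\<close> adds \<open>(Im w)^2\<close>, so that
    \<open>Re P = 1 + 2 (Re w - (Re w)^2) >= 1\<close> on the arc.\<close>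
  define P where "P z = 2 * ((1 - cnj \<zeta> * z) / of_real \<rho>) - ((1 - cnj \<zeta> * z) / of_real \<rho>)\<^sup>2" for z
  have qnn: "0 \<le> Re (P z)" and q1: "norm (z - \<zeta>) = \<rho> \<Longrightarrow> 1 \<le> Re (P z)"
    if "norm z \<le> 1" "norm (z - \<zeta>) \<le> \<rho>" for z
  proof -
    define w where "w = (1 - cnj \<zeta> * z) / of_real \<rho>"
    have "1 - cnj \<zeta> * z = cnj \<zeta> * (\<zeta> - z)"
      using \<zeta>1 by (simp add: algebra_simps)
    then have nw: "norm w = norm (z - \<zeta>) / \<rho>"
      using \<zeta> \<rho> by (simp add: w_def norm_divide norm_mult norm_minus_commute)
    have "Re (cnj \<zeta> * z) \<le> 1"
      using complex_Re_le_cmod[of "cnj \<zeta> * z"] that \<zeta> by (simp only: norm_mult complex_mod_cnj)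
    then have u0: "0 \<le> Re w"
      using \<rho> by (simp add: w_def)
    have "norm w \<le> 1"
      using nw that \<rho> by simp
    then have u1: "Re w \<le> 1"
      using complex_Re_le_cmod[of w] by linarith
    have PR: "Re (P z) = 2 * Re w - (Re w)\<^sup>2 + (Im w)\<^sup>2"
      by (simp add: P_def w_def[symmetric] power2_eq_square)
    have sq: "(Re w)\<^sup>2 \<le> Re w"
      using u0 u1 by (simp add: power2_eq_square mult_left_le_one_le)
    show "0 \<le> Re (P z)"
      unfolding PR using sq u0 zero_le_power2[of "Im w"] by linarith
    show "1 \<le> Re (P z)" if "norm (z - \<zeta>) = \<rho>"
    proof -
      have "(Re w)\<^sup>2 + (Im w)\<^sup>2 = 1"
        using nw that \<rho> cmod_power2[of w] by simp
      then show ?thesis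
        unfolding PR using sq by linarith
    qed
  qed
  define V where "V = ball 0 1 \<inter> ball \<zeta> \<rho>"
  define h where "h z = exp (- of_real \<kappa> * P z) / f z" for z
  have fnz: "C \<le> norm (f z)" if "z \<in> V" for z
    using that ge by (auto simp: V_def dist_norm norm_minus_commute)
  then have fnz': "f z \<noteq> 0" if "z \<in> V" for z
    using C that by force
  have nexp: "norm (exp (- of_real \<kappa> * P z)) = exp (- \<kappa> * Re (P z))" for z
    by (simp add: norm_exp_eq_Re)
  have t\<zeta>: "of_real t * \<zeta> \<in> V"
  proof -
    have "\<zeta> - of_real t * \<zeta> = of_real (1 - t) * \<zeta>"
      by (simp add: algebra_simps)
    then have "norm (\<zeta> - of_real t * \<zeta>) = 1 - t"
      using t \<zeta> by (simp add: norm_mult del: of_real_diff)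
    then show ?thesis
      using t \<zeta> by (auto simp: V_def dist_norm norm_mult)
  qed
  have "norm (h (of_real t * \<zeta>)) \<le> 1"
  proof (rule maximum_modulus_limsup[of V h 1])
    show "open V" "bounded V"
      by (auto simp: V_def bounded_Int)
    show "connected V"
      unfolding V_def by (intro convex_connected convex_Int convex_ball)
    show "h holomorphic_on V"
      unfolding h_def P_def using \<rho> fnz'
      by (intro holomorphic_intros holomorphic_on_subset[OF f]) (auto simp: V_def)
    fix w and s :: real assume w: "w \<in> frontier V" and s: "s > 1"
    have clV: "closure V \<subseteq> cball 0 1 \<inter> cball \<zeta> \<rho>"
      by (rule closure_minimal) (auto simp: V_def)
    have w': "norm w \<le> 1" "norm (w - \<zeta>) \<le> \<rho>" "w \<notin> V"
      using w clV \<open>open V\<close> by (auto simp: frontier_def interior_open dist_norm norm_minus_commute)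
    then consider "norm (w - \<zeta>) = \<rho>" | "norm w = 1" "norm (w - \<zeta>) < \<rho>"
      by (fastforce simp: V_def dist_norm norm_minus_commute)
    then show "eventually (\<lambda>z. norm (h z) < s) (at w within V)"
    proof cases
      case 1
      have "exp (- \<kappa> * Re (P w)) / C \<le> exp (- \<kappa> * 1) / C"
        using mult_left_mono[OF q1[OF w'(1,2) 1] \<kappa>(1)] C by (intro divide_right_mono) auto
      also have "\<dots> = 1"
        using \<kappa> C by (simp add: exp_minus)
      finally have lt: "exp (- \<kappa> * Re (P w)) / C < s"
        using s by simp
      have "((\<lambda>z. exp (- \<kappa> * Re (P z)) / C) \<longlongrightarrow> exp (- \<kappa> * Re (P w)) / C) (at w within V)"
        unfolding P_def using C \<rho> by (intro tendsto_intros) auto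
      then have "eventually (\<lambda>z. exp (- \<kappa> * Re (P z)) / C < s) (at w within V)"
        using lt by (rule order_tendstoD)
      moreover have "eventually (\<lambda>z. z \<in> V) (at w within V)"
        by (simp add: eventually_at_filter)
      ultimately show ?thesis
      proof eventually_elim
        case (elim z)
        have "norm (h z) = exp (- \<kappa> * Re (P z)) / norm (f z)"
          by (simp only: h_def norm_divide nexp)
        also have "\<dots> \<le> exp (- \<kappa> * Re (P z)) / C"
          using fnz[OF elim(2)] C by (intro divide_left_mono mult_pos_pos) auto
        finally show ?case
          using elim by linarith
      qed
    next
      case 2
      have "eventually (\<lambda>z. 1 / s < norm (f z)) (at w within ball 0 1)"
        using 2 s by (intro bd) auto
      then have "eventually (\<lambda>z. 1 / s < norm (f z)) (at w within V)"
        by (rule filter_leD[rotated]) (auto intro!: at_le simp: V_def)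
      moreover have "eventually (\<lambda>z. z \<in> V) (at w within V)"
        by (simp add: eventually_at_filter)
      ultimately show ?thesis
      proof eventually_elim
        case (elim z)
        have "norm (h z) = exp (- \<kappa> * Re (P z)) / norm (f z)"
          by (simp only: h_def norm_divide nexp)
        also have "\<dots> \<le> 1 / norm (f z)"
          using qnn[of z] elim(2) \<kappa>(1) by (intro divide_right_mono) (auto simp: V_def dist_norm norm_minus_commute)
        also have "\<dots> < s"
          using elim s fnz'[OF elim(2)] by (simp add: field_simps)
        finally show ?case .
      qed
    qed
  qed (rule t\<zeta>)
  then have "exp (- \<kappa> * Re (P (of_real t * \<zeta>))) \<le> norm (f (of_real t * \<zeta>))"
    using fnz'[OF t\<zeta>] unfolding h_def norm_divide nexp by (simp add: field_simps)
  moreover have "1 + - \<kappa> * Re (P (of_real t * \<zeta>)) \<le> exp (- \<kappa> * Re (P (of_real t * \<zeta>)))"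
    by (rule exp_ge_add_one_self)
  moreover have "\<kappa> * Re (P (of_real t * \<zeta>)) \<le> 2 * \<kappa> * (1 - t) / \<rho>"
  proof -
    have "1 - cnj \<zeta> * (of_real t * \<zeta>) = of_real (1 - t)"
      using \<zeta>1 by (simp add: mult.left_commute)
    then have "P (of_real t * \<zeta>) = of_real (2 * ((1 - t) / \<rho>) - ((1 - t) / \<rho>)\<^sup>2)"
      by (simp only: P_def) simp
    then have "Re (P (of_real t * \<zeta>)) = 2 * ((1 - t) / \<rho>) - ((1 - t) / \<rho>)\<^sup>2"
      by (simp only: Re_complex_of_real)
    then have "\<kappa> * Re (P (of_real t * \<zeta>)) \<le> \<kappa> * (2 * ((1 - t) / \<rho>))"
      using \<kappa>(1) by (intro mult_left_mono) auto
    then show ?thesis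
      by (simp add: mult_ac)
  qed
  ultimately show ?thesis
    unfolding \<kappa>_def[symmetric] by linarith
qed

section \<open>The spectrum, the unit norm and sublevel sets\<close>

lemma eventually_norm_gt_of_not_spec:
  assumes "norm \<xi> = 1" "\<xi> \<notin> spec b" "s < 1"
  shows "eventually (\<lambda>z. s < norm (b z)) (at \<xi> within ball 0 1)"
proof -
  have "ereal s < Liminf (at \<xi> within ball 0 1) (\<lambda>z. ereal (norm (b z)))"
    using assms by (auto simp: spec_def not_less intro: less_le_trans[of _ 1])
  then show ?thesis
    by (auto dest!: less_LiminfD)
qed

lemma in_spec_of_closure:
  assumes "norm \<xi> = 1" "s < 1" "\<xi> \<in> closure {z\<in>ball 0 1. norm (b z) \<le> s}"
  shows "\<xi> \<in> spec b"
proof (rule ccontr)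
  assume "\<xi> \<notin> spec b"
  then have "eventually (\<lambda>z. s < norm (b z)) (at \<xi> within ball 0 1)"
    using assms by (intro eventually_norm_gt_of_not_spec)
  moreover have "\<xi> islimpt {z\<in>ball 0 1. norm (b z) \<le> s}"
    using assms by (auto simp: closure_def)
  then have "frequently (\<lambda>z. z \<in> ball 0 1 \<and> norm (b z) \<le> s) (at \<xi>)"
    by (simp add: islimpt_conv_frequently_at)
  ultimately show False
    unfolding frequently_def eventually_at_filter by (auto simp: not_le)
qed

lemma Hinf_unitD:
  assumes "Hinf_unit b"
  shows "b holomorphic_on ball 0 1" "norm z < 1 \<Longrightarrow> norm (b z) \<le> 1"
proof -
  show "b holomorphic_on ball 0 1"
    using assms by (simp add: Hinf_unit_def)
  have "bdd_above ((\<lambda>z. norm (b z)) ` ball 0 1)"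
    using assms by (auto simp: Hinf_unit_def bounded_iff bdd_above_def)
  then show "norm (b z) \<le> 1" if "norm z < 1"
    using cSUP_upper[of z "ball 0 1" "\<lambda>z. norm (b z)"] that assms by (simp add: Hinf_unit_def)
qed

lemma Hinf_unit_constantD:
  assumes "Hinf_unit b" "b constant_on ball 0 1"
  obtains c where "norm c = 1" "\<And>z. norm z < 1 \<Longrightarrow> b z = c"
proof -
  obtain c where c: "\<And>z. z \<in> ball 0 1 \<Longrightarrow> b z = c"
    using assms(2) by (auto simp: constant_on_def)
  then have "(SUP z\<in>ball (0::complex) 1. norm (b z)) = (SUP z\<in>ball (0::complex) 1. norm c)"
    by (intro SUP_cong) auto
  then have "norm c = 1"
    using assms(1) by (simp add: Hinf_unit_def)
  then show ?thesis
    using c that by simp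
qed

lemma Hinf_unit_nonconstantD:
  assumes "Hinf_unit b" "\<not> b constant_on ball 0 1" "norm z < 1"
  shows "norm (b z) < 1"
proof (rule ccontr)
  assume "\<not> norm (b z) < 1"
  then have "\<And>w. w \<in> ball 0 1 \<Longrightarrow> norm (b w) \<le> norm (b z)"
    using Hinf_unitD[OF assms(1)] by (meson linorder_not_less mem_ball_0 order_trans)
  then show False
    using maximum_modulus_principle[OF Hinf_unitD(1)[OF assms(1)], of "ball 0 1" z] assms by auto
qed

text \<open>By the open mapping theorem the values of \<open>b\<close> near \<open>z\<close> fill a
  disc around \<open>b z\<close>, which contains values closer to 0. This links the non-strict
  inequality in the closure condition with the strict one in the connectedness condition.\<close>

lemma strict_sublevel_meets:
  assumes b: "b holomorphic_on ball 0 1" "\<not> b constant_on ball 0 1"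
    and C: "0 < C" and U: "open U" "z \<in> U" "norm z < 1" "norm (b z) \<le> C"
  shows "\<exists>w\<in>U. norm w < 1 \<and> norm (b w) < C"
proof (cases "b z = 0")
  case True
  then show ?thesis
    using U C by auto
next
  case False
  have "open (b ` (U \<inter> ball 0 1))"
    using b U(1) by (intro open_mapping_thm[of b "ball 0 1"]) auto
  then obtain e where e: "e > 0" "ball (b z) e \<subseteq> b ` (U \<inter> ball 0 1)"
    using U openE[of "b ` (U \<inter> ball 0 1)" "b z"] by auto
  \<comment> \<open>The first bound keeps \<open>y\<close> inside the disc of values, the second
    keeps the shift towards 0 from passing 0.\<close>
  define d where "d = min (e / 2) (norm (b z))"
  have d: "d > 0" "d < e" "d \<le> norm (b z)"
    using e(1) False by (simp_all add: d_def min_def)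
  define y where "y = of_real (1 - d / norm (b z)) * b z"
  have "b z - y = of_real (d / norm (b z)) * b z"
    by (simp add: y_def algebra_simps)
  then have "norm (b z - y) = d"
    using d False by (simp add: norm_mult norm_divide)
  then have "y \<in> ball (b z) e"
    using d by (simp add: dist_norm)
  then obtain w where w: "w \<in> U" "norm w < 1" "b w = y"
    using e by auto
  have "d / norm (b z) \<le> 1"
    using d by (simp add: divide_le_eq_1)
  then have "norm y = (1 - d / norm (b z)) * norm (b z)"
    by (simp add: y_def norm_mult del: of_real_diff)
  also have "\<dots> = norm (b z) - d"
    using False by (simp add: algebra_simps)
  finally show ?thesis
    using w d U(4) by (intro bexI[of _ w]) auto
qed

text \<open>Otherwise the spectrum is empty, so \<open>|b|\<close> tends to 1 at the whole circle,
  and the maximum principle for the bounded function \<open>1 / b\<close> gives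
  \<open>|b(0)| >= 1\<close>.\<close>

lemma strict_sublevel_nonempty:
  assumes b: "Hinf_unit b" "\<not> b constant_on ball 0 1" and C: "0 < C"
    and sub: "spec b \<subseteq> closure {z\<in>ball 0 1. norm (b z) \<le> C}"
  shows "\<exists>z. norm z < 1 \<and> norm (b z) < C"
proof (rule ccontr)
  assume no: "\<not> ?thesis"
  have C': "norm (b z) > C" if "norm z < 1" for z
    using strict_sublevel_meets[OF Hinf_unitD(1)[OF b(1)] b(2) C open_UNIV _ that] no
    by (meson UNIV_I linorder_not_le)
  then have "{z\<in>ball 0 1. norm (b z) \<le> C} = {}"
    by force
  then have "spec b = {}"
    using sub by (metis closure_empty subset_empty)
  have "norm (1 / b 0) \<le> 1"
  proof (rule maximum_modulus_limsup[of "ball 0 1" "\<lambda>z. 1 / b z" 1 0])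
    have "b z \<noteq> 0" if "norm z < 1" for z
      using C'[OF that] C by auto
    then show "(\<lambda>z. 1 / b z) holomorphic_on ball 0 1"
      by (intro holomorphic_intros Hinf_unitD(1)[OF b(1)]) auto
    fix w :: complex and s :: real assume w: "w \<in> frontier (ball 0 1)" and s: "s > 1"
    have "eventually (\<lambda>z. 1 / s < norm (b z)) (at w within ball 0 1)"
      using w s \<open>spec b = {}\<close> by (intro eventually_norm_gt_of_not_spec) auto
    then show "eventually (\<lambda>z. norm (1 / b z) < s) (at w within ball 0 1)"
    proof eventually_elim
      case (elim z)
      moreover have "0 < norm (b z)"
        using elim s by (smt (verit) divide_pos_pos)
      ultimately show ?case
        using s by (simp add: norm_divide field_simps)
    qed
  qed auto
  moreover have "0 < norm (b 0)" "norm (b 0) < 1"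
    using C'[of 0] C Hinf_unit_nonconstantD[OF b, of 0] by auto
  ultimately show False
    by (simp add: norm_divide field_simps)
qed

section \<open>The kernel estimate for (a)\<close>

lemma kernel_bound:
  assumes b: "Hinf_unit b" "\<not> b constant_on ball 0 1" and C: "0 < C" "C < 1"
    and sub: "spec b \<subseteq> closure {z\<in>ball 0 1. norm (b z) \<le> C}"
    and conn: "connected {z\<in>ball 0 1. norm (b z) < C}"
  shows "\<exists>K>0. \<forall>a z. norm a < 1 \<longrightarrow> norm z < 1 \<longrightarrow>
    norm ((1 - cnj (b a) * b z) / (1 - cnj a * z)) \<le> K * (1 - (norm (b a))\<^sup>2) / (1 - (norm a)\<^sup>2)"
proof -
  define S where "S = {z\<in>ball 0 1. norm (b z) < C}"
  have hol: "b holomorphic_on ball 0 1"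
    using b Hinf_unitD by blast
  have lt1: "norm (b z) < 1" if "norm z < 1" for z
    using Hinf_unit_nonconstantD[OF b that] .
  have S: "open S" "connected S" "S \<subseteq> ball 0 1" "\<And>z. z \<in> S \<Longrightarrow> norm (b z) \<le> C"
  proof -
    have "S = ball 0 1 \<inter> b -` ball 0 C"
      by (auto simp: S_def)
    then show "open S"
      using continuous_open_preimage[OF holomorphic_on_imp_continuous_on[OF hol]] by auto
  qed (use conn in \<open>auto simp: S_def\<close>)
  obtain p where p: "p \<in> S"
    using strict_sublevel_nonempty[OF b C(1) sub] by (auto simp: S_def)
  define c where "c = (1 - norm p) * (1 - sqrt C)\<^sup>2 / 8"
  have c: "c > 0"
    using p C by (auto simp: S_def c_def)
  define \<kappa> where "\<kappa> = ln (1 / C)"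
  have \<kappa>: "\<kappa> \<ge> 0"
    using C by (simp add: \<kappa>_def)
  show ?thesis
  \<comment> \<open>One summand for each case below: \<open>32 / c\<close> when
    \<open>r >= R / 16\<close>, the square root when \<open>z\<close> is closer and Schwarz-Pick is
    used.\<close>
  proof (intro exI[of _ "32 / c + sqrt (16 * \<kappa> / c)"] conjI allI impI)
    show "0 < 32 / c + sqrt (16 * \<kappa> / c)"
      using c \<kappa> by (intro add_pos_nonneg) auto
    fix a z :: complex assume a: "norm a < 1" and z: "norm z < 1"
    define Q where "Q w = (1 - (norm (b w))\<^sup>2) / (1 - (norm w)\<^sup>2)" for w
    define k where "k = norm ((1 - cnj (b a) * b z) / (1 - cnj a * z))"
    define r where "r = norm (1 - cnj a * z)"
    have r: "r > 0" "1 - norm z \<le> r"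
      using disc_one_minus_nonzero[OF a z] one_minus_norm_le[of a z] a z by (auto simp: r_def)
    have P: "0 < 1 - (norm a)\<^sup>2" "0 < 1 - (norm z)\<^sup>2" "0 < 1 - (norm (b a))\<^sup>2"
      using a z lt1[OF a] by (auto simp: power_less_one_iff)
    have Qa: "Q a > 0"
      using P by (simp add: Q_def)
    define R where "R = c / Q a"
    have R: "R > 0"
      using c Qa by (simp add: R_def)
    have RS: "R \<le> norm (1 - cnj a * w)" if "w \<in> S" for w
    proof -
      have "c * (1 - (norm a)\<^sup>2) \<le> (1 - (norm (b a))\<^sup>2) * norm (1 - cnj a * w)"
        unfolding c_def by (rule level_set_estimate[OF hol lt1 S C p that a])
      moreover have "R = c * (1 - (norm a)\<^sup>2) / (1 - (norm (b a))\<^sup>2)"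
        by (simp add: R_def Q_def)
      ultimately show ?thesis
        using P(3) by (simp only: pos_divide_le_eq mult.commute)
    qed
    have "k \<le> (32 / c + sqrt (16 * \<kappa> / c)) * Q a"
    proof (cases "r \<ge> R / 16")
      case True
      have "norm (1 - cnj (b a) * b z) \<le> 2"
        using one_minus_norm_le(3)[of "b a" "b z"] lt1[OF a] lt1[OF z] by auto
      then have "k \<le> 2 / r"
        using r by (simp add: k_def norm_divide r_def divide_right_mono)
      also have "\<dots> \<le> 2 / (R / 16)"
        using True R by (intro divide_left_mono) auto
      also have "\<dots> = 32 / c * Q a"
        by (simp add: R_def)
      also have "\<dots> \<le> (32 / c + sqrt (16 * \<kappa> / c)) * Q a"
        using Qa c \<kappa> by (intro mult_right_mono) auto
      finally show ?thesis .
    next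
      case False
      have "R \<le> 2"
        using RS[OF p] one_minus_norm_le(3)[of a p] a p by (auto simp: S_def)
      then have zpos: "norm z > 0" "1 - norm z < R / 16"
        using False r by auto
      define \<zeta> where "\<zeta> = z / of_real (norm z)"
      have \<zeta>: "norm \<zeta> = 1" "of_real (norm z) * \<zeta> = z"
        using zpos by (auto simp: \<zeta>_def norm_divide)
      have z\<zeta>: "norm (z - \<zeta>) = 1 - norm z"
      proof -
        have "\<zeta> - z = of_real (1 - norm z) * \<zeta>"
          using \<zeta>(2) by (simp add: algebra_simps)
        then show ?thesis
          using \<zeta>(1) z by (simp add: norm_mult norm_minus_commute del: of_real_diff)
      qed
      \<comment> \<open>The distances add up to less than \<open>R / 16 + R / 16 + R / 4\<close>, so
        a point of \<open>S\<close> here would contradict \<open>RS\<close>.\<close>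
      have far: "w \<notin> S" if w: "norm (w - \<zeta>) < R / 4" for w
      proof
        assume "w \<in> S"
        have "1 - cnj a * w = (1 - cnj a * z) + cnj a * ((z - \<zeta>) - (w - \<zeta>))"
          by (simp add: algebra_simps)
        then have "norm (1 - cnj a * w) \<le> r + norm a * norm ((z - \<zeta>) - (w - \<zeta>))"
          unfolding r_def by (metis norm_triangle_ineq norm_mult complex_mod_cnj)
        also have "\<dots> \<le> r + 1 * (norm (z - \<zeta>) + norm (w - \<zeta>))"
          using a norm_triangle_ineq4[of "z - \<zeta>" "w - \<zeta>"] by (intro add_left_mono mult_mono) auto
        also have "\<dots> < R"
          using w z\<zeta> zpos False R by auto
        finally show False
          using RS[OF \<open>w \<in> S\<close>] by simp
      qed
      have "1 - 2 * ln (1 / C) * (1 - norm z) / (R / 4) \<le> norm (b (of_real (norm z) * \<zeta>))"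
      proof (rule barrier_bound[OF hol])
        show "C \<le> norm (b w)" if "norm w < 1" "norm (w - \<zeta>) < R / 4" for w
          using far[OF that(2)] that(1) by (auto simp: S_def)
        show "eventually (\<lambda>z. s < norm (b z)) (at w within ball 0 1)"
          if w: "norm w = 1" "norm (w - \<zeta>) < R / 4" and s: "s < 1" for w s
        proof (rule eventually_norm_gt_of_not_spec[OF w(1) _ s])
          \<comment> \<open>A spectral point this close would be a limit of points with
            \<open>|b| <= C\<close>, and the open mapping theorem would produce a point of
            \<open>S\<close> in the excluded disc.\<close>
          show "w \<notin> spec b"
          proof
            assume "w \<in> spec b"
            then have "w \<in> closure {z\<in>ball 0 1. norm (b z) \<le> C}"
              using sub by blast
            moreover have "w \<in> ball \<zeta> (R / 4)"
              using w by (simp add: dist_norm norm_minus_commute)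
            ultimately obtain y where "y \<in> ball \<zeta> (R / 4)" "norm y < 1" "norm (b y) \<le> C"
              using open_Int_closure_eq_empty[OF open_ball, of \<zeta> "R / 4" "{z\<in>ball 0 1. norm (b z) \<le> C}"] by auto
            then obtain y where "y \<in> ball \<zeta> (R / 4)" "norm y < 1" "norm (b y) < C"
              using strict_sublevel_meets[OF hol b(2) C(1) open_ball] by blast
            then show False
              using far[of y] by (simp add: S_def dist_norm norm_minus_commute)
          qed
        qed
      qed (use C \<zeta> R z zpos in auto)
      then have bz: "1 - norm (b z) \<le> 8 * \<kappa> * (1 - norm z) / R"
        using \<zeta>(2) by (simp add: \<kappa>_def)
      have "1 - (norm (b z))\<^sup>2 = (1 - norm (b z)) * (1 + norm (b z))"
        by (simp add: power2_eq_square algebra_simps)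
      also have "\<dots> \<le> (8 * \<kappa> * (1 - norm z) / R) * 2"
        using bz lt1[OF z] z \<kappa> R by (intro mult_mono) auto
      also have "\<dots> = 16 * \<kappa> / R * (1 - norm z)"
        by simp
      also have "\<dots> \<le> 16 * \<kappa> / R * (1 - (norm z)\<^sup>2)"
        using \<kappa> R z by (intro mult_left_mono) (auto simp: power2_eq_square mult_left_le_one_le)
      finally have Qz: "Q z \<le> 16 * \<kappa> / R"
        using P by (simp add: Q_def pos_divide_le_eq)
      have "k\<^sup>2 \<le> Q a * Q z"
      proof -
        \<comment> \<open>Rearranges the product form of Schwarz-Pick into quotients, with
          \<open>y\<close> the squared modulus of \<open>1 - cnj a z\<close>.\<close>
        have "X / y \<le> (u / \<alpha>) * (v / \<beta>)"
          if "X * (\<alpha> * \<beta>) \<le> u * v * y" "\<alpha> > 0" "\<beta> > 0" "y > 0" for X y u v \<alpha> \<beta> :: real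
          using that by (simp add: field_simps)
        from this[OF Schwarz_Pick[OF hol lt1 a z] P(1,2)] show ?thesis
          using r by (simp add: k_def Q_def norm_divide power_divide r_def)
      qed
      also have "\<dots> \<le> Q a * (16 * \<kappa> / R)"
        using Qz Qa by (intro mult_left_mono) auto
      also have "\<dots> = (sqrt (16 * \<kappa> / c) * Q a)\<^sup>2"
        using \<kappa> c by (simp add: R_def power_mult_distrib) (simp add: power2_eq_square)
      finally have "k \<le> sqrt (16 * \<kappa> / c) * Q a"
        by (rule power2_le_imp_le) (use Qa \<kappa> c in auto)
      also have "\<dots> \<le> (32 / c + sqrt (16 * \<kappa> / c)) * Q a"
        using Qa c by (intro mult_right_mono) auto
      finally show ?thesis .
    qed
    then show "norm ((1 - cnj (b a) * b z) / (1 - cnj a * z))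
      \<le> (32 / c + sqrt (16 * \<kappa> / c)) * (1 - (norm (b a))\<^sup>2) / (1 - (norm a)\<^sup>2)"
      by (simp add: k_def Q_def)
  qed
qed

section \<open>Connectedness of sublevel sets for (b)\<close>

text \<open>Cut the plane along the ray through one point of \<open>E\<close>. The argument maps
  \<open>V\<close> onto an interval, and any other point of \<open>E\<close> has its argument in the
  closure of that interval but not in it, hence at an endpoint. So \<open>E\<close> has at most
  three points.\<close>

lemma finite_radial_accessible_points:
  assumes V: "connected V" "V \<subseteq> ball 0 1" "0 \<notin> V"
    and E: "E \<subseteq> closure V \<inter> sphere (0::complex) 1"
    and avoid: "\<And>\<xi> t. \<lbrakk>\<xi> \<in> E; 0 < t; t < 1\<rbrakk> \<Longrightarrow> of_real t * \<xi> \<notin> V"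
  shows "finite E"
proof (cases "E = {}")
  case False
  then obtain \<xi>\<^sub>1 where \<xi>1: "\<xi>\<^sub>1 \<in> E"
    by blast
  have nE: "norm \<xi> = 1" "\<xi> \<noteq> 0" if "\<xi> \<in> E" for \<xi>
    using E that by auto
  have nV: "of_real x * \<xi> \<notin> V" if "\<xi> \<in> E" "x > 0" for \<xi> x
    using avoid[OF that] V(2) nE(1)[OF that(1)] that(2) by (cases "x < 1") (auto simp: norm_mult)
  \<comment> \<open>The minus sign puts the branch cut of \<open>Arg\<close> on the ray through
    \<open>\<xi>\<^sub>1\<close>, which misses \<open>V\<close>.\<close>
  define \<theta> where "\<theta> z = Arg (- z / \<xi>\<^sub>1)" for z
  have slit: "- z / \<xi>\<^sub>1 \<notin> \<real>\<^sub>\<le>\<^sub>0" if "\<And>x. x \<ge> 0 \<Longrightarrow> z \<noteq> of_real x * \<xi>\<^sub>1" for z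
  proof
    assume "- z / \<xi>\<^sub>1 \<in> \<real>\<^sub>\<le>\<^sub>0"
    then obtain x where "x \<le> 0" "- z / \<xi>\<^sub>1 = of_real x"
      by (blast elim!: nonpos_Reals_cases)
    then have "- x \<ge> 0" "z = of_real (- x) * \<xi>\<^sub>1"
      using nE[OF \<xi>1] by (auto simp: field_simps minus_equation_iff[of z])
    then show False
      using that by blast
  qed
  have slitV: "- z / \<xi>\<^sub>1 \<notin> \<real>\<^sub>\<le>\<^sub>0" if "z \<in> V" for z
  proof (rule slit)
    fix x :: real assume "x \<ge> 0"
    then show "z \<noteq> of_real x * \<xi>\<^sub>1"
      using nV[OF \<xi>1, of x] that V(3) by (cases "x = 0") auto
  qed
  have slitE: "- \<xi> / \<xi>\<^sub>1 \<notin> \<real>\<^sub>\<le>\<^sub>0" if "\<xi> \<in> E - {\<xi>\<^sub>1}" for \<xi>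
  proof (rule slit)
    fix x :: real assume "x \<ge> 0"
    show "\<xi> \<noteq> of_real x * \<xi>\<^sub>1"
    proof
      assume "\<xi> = of_real x * \<xi>\<^sub>1"
      moreover from this have "x = 1"
        using nE[of \<xi>] nE[OF \<xi>1] that \<open>x \<ge> 0\<close> by (auto simp: norm_mult)
      ultimately show False
        using that by auto
    qed
  qed
  have \<theta>_eq: "\<exists>x>0. z = of_real x * \<xi>" if "\<theta> z = \<theta> \<xi>" "z \<noteq> 0" "\<xi> \<noteq> 0" for z \<xi>
  proof -
    have "\<exists>x>0. - z / \<xi>\<^sub>1 = of_real x * (- \<xi> / \<xi>\<^sub>1)"
      using that nE[OF \<xi>1] by (subst Arg_eq_iff[symmetric]) (auto simp: \<theta>_def)
    then show ?thesis
      using nE[OF \<xi>1] by (auto simp: field_simps)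
  qed
  define J where "J = \<theta> ` V"
  have "continuous_on V \<theta>"
    unfolding \<theta>_def using slitV nE[OF \<xi>1] by (intro continuous_intros) auto
  then have "connected J"
    unfolding J_def using V(1) by (intro connected_continuous_image)
  then have ivl: "is_interval J"
    by (simp add: is_interval_connected_1)
  have Jsub: "J \<subseteq> {-pi..pi}"
    using less_imp_le[OF mpi_less_Arg] Arg_le_pi by (auto simp: J_def \<theta>_def)
  then have bdd: "bdd_above J" "bdd_below J"
    by (meson bdd_above_Icc bdd_above_mono, meson bdd_below_Icc bdd_below_mono)
  have "\<theta> ` (E - {\<xi>\<^sub>1}) \<subseteq> {Inf J, Sup J}"
  proof
    fix y assume "y \<in> \<theta> ` (E - {\<xi>\<^sub>1})"
    then obtain \<xi> where \<xi>: "\<xi> \<in> E - {\<xi>\<^sub>1}" "y = \<theta> \<xi>"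
      by blast
    have "\<xi> \<in> closure V"
      using \<xi> E by auto
    then obtain u where u: "\<And>n. u n \<in> V" "u \<longlonglongrightarrow> \<xi>"
      by (auto simp: closure_sequential)
    have "(\<lambda>n. \<theta> (u n)) \<longlonglongrightarrow> \<theta> \<xi>"
      unfolding \<theta>_def using slitE[OF \<xi>(1)] nE[OF \<xi>1] u(2) by (intro tendsto_intros) auto
    then have "y \<in> closure J"
      unfolding closure_sequential \<xi>(2) J_def using u(1) by (intro exI[of _ "\<lambda>n. \<theta> (u n)"]) auto
    moreover have "closure J \<subseteq> {Inf J..Sup J}"
      using bdd by (intro closure_minimal) (auto intro: cInf_lower cSup_upper)
    ultimately have y: "Inf J \<le> y" "y \<le> Sup J" "J \<noteq> {}"
      by auto
    have "y \<notin> J"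
    proof
      assume "y \<in> J"
      then obtain z where z: "z \<in> V" "\<theta> z = \<theta> \<xi>"
        using \<xi>(2) by (auto simp: J_def)
      then show False
        using \<theta>_eq[OF z(2)] nV[of \<xi>] nE[of \<xi>] \<xi>(1) V(3) by auto
    qed
    show "y \<in> {Inf J, Sup J}"
    proof (rule ccontr)
      assume "y \<notin> {Inf J, Sup J}"
      then have "Inf J < y" "y < Sup J"
        using y by auto
      then obtain i j where "i \<in> J" "j \<in> J" "i < y" "y < j"
        using y(3) bdd by (metis cInf_less_iff less_cSup_iff)
      then have "y \<in> J"
        using ivl unfolding is_interval_1 by (meson less_imp_le)
      with \<open>y \<notin> J\<close> show False ..
    qed
  qed
  then have "finite (\<theta> ` (E - {\<xi>\<^sub>1}))"
    using finite_subset by blast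
  moreover have "inj_on \<theta> (E - {\<xi>\<^sub>1})"
  proof (rule inj_onI)
    fix x y assume xy: "x \<in> E - {\<xi>\<^sub>1}" "y \<in> E - {\<xi>\<^sub>1}" "\<theta> x = \<theta> y"
    then obtain t where t: "t > 0" "x = of_real t * y"
      using \<theta>_eq[of x y] nE by auto
    then have "t = 1"
      using nE[of x] nE[of y] xy by (auto simp: norm_mult)
    then show "x = y"
      using t by simp
  qed
  ultimately have "finite (E - {\<xi>\<^sub>1})"
    by (rule finite_imageD)
  then show ?thesis
    by simp
qed simp

text \<open>All radii ending in the lower sublevel set or in the spectrum lie in the component of 0,
  because \<open>D < C'\<close>. On any other component \<open>V\<close> therefore
  \<open>|b| > C\<close>, and \<open>1 / b\<close> is bounded there, which makes finitely many
  boundary points negligible.\<close>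

lemma connected_sublevel_of_radial:
  assumes b: "Hinf_unit b" "\<not> b constant_on ball 0 1" and C: "0 < C" "C \<le> C'" "D < C'" "C' < 1"
    and sub: "spec b \<subseteq> closure {z\<in>ball 0 1. norm (b z) \<le> C}"
    and radial: "\<And>z t. \<lbrakk>norm z < 1; norm (b z) \<le> C; 0 \<le> t; t \<le> 1\<rbrakk> \<Longrightarrow> norm (b (of_real t * z)) \<le> D"
  shows "connected {z\<in>ball 0 1. norm (b z) < C'}"
proof -
  define \<Omega> where "\<Omega> = {z\<in>ball 0 1. norm (b z) < C'}"
  have hol: "b holomorphic_on ball 0 1"
    using b Hinf_unitD by blast
  then have cont: "continuous_on (ball 0 1) b"
    by (rule holomorphic_on_imp_continuous_on)
  have lim: "(b \<longlongrightarrow> b w) (at w within V)" if "norm w < 1" for w V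
  proof -
    have "isCont b w"
      using cont that by (simp add: continuous_on_eq_continuous_at)
    then show ?thesis
      unfolding isCont_def by (rule tendsto_within_subset) simp
  qed
  have "\<Omega> = ball 0 1 \<inter> b -` ball 0 C'"
    by (auto simp: \<Omega>_def)
  then have op: "open \<Omega>"
    using continuous_open_preimage[OF cont] by auto
  have to0: "connected_component \<Omega> 0 (of_real t * z)"
    if t: "norm (of_real t * z) < 1" "t \<ge> 0" and le: "\<And>s. 0 \<le> s \<Longrightarrow> s \<le> t \<Longrightarrow> norm (b (of_real s * z)) \<le> D" for z t
  proof -
    have "x \<in> \<Omega>" if "x \<in> closed_segment 0 (of_real t * z)" for x
    proof -
      obtain u where u: "0 \<le> u" "u \<le> 1" "x = of_real (u * t) * z"
        using \<open>x \<in> closed_segment 0 (of_real t * z)\<close> by (auto simp: closed_segment_def scaleR_conv_of_real)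
      have "norm x \<le> norm (of_real t * z)"
        using u t by (simp add: norm_mult mult_left_le_one_le mult.assoc)
      then show ?thesis
        using u t le[of "u * t"] C by (auto simp: \<Omega>_def mult_left_le_one_le)
    qed
    then show ?thesis
      unfolding connected_component_def by (intro exI[of _ "closed_segment 0 (of_real t * z)"]) auto
  qed
  have sub0: "connected_component \<Omega> 0 z" if "norm z < 1" "norm (b z) \<le> C" for z
    using to0[of 1 z] radial[OF that] that by simp
  obtain z\<^sub>1 where z1: "norm z\<^sub>1 < 1" "norm (b z\<^sub>1) < C"
    using strict_sublevel_nonempty[OF b C(1) sub] by blast
  then have "norm (b 0) \<le> D"
    using radial[of z\<^sub>1 0] by simp
  then have "connected_component \<Omega> 0 0"
    using to0[of 0 0] by simp
  \<comment> \<open>A spectral point is a limit of points with \<open>|b| <= C\<close>; the bound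
    \<open>D\<close> on their radii passes to the limit by continuity inside the disc.\<close>
  have radii: "connected_component \<Omega> 0 (of_real t * \<xi>)" if \<xi>: "\<xi> \<in> spec b" and t: "0 < t" "t < 1" for \<xi> t
  proof (rule to0)
    have n: "norm \<xi> = 1"
      using \<xi> by (simp add: spec_def)
    then show "norm (of_real t * \<xi>) < 1" "t \<ge> 0"
      using t by (auto simp: norm_mult)
    fix s :: real assume s: "0 \<le> s" "s \<le> t"
    obtain u where u: "\<And>n. u n \<in> {z\<in>ball 0 1. norm (b z) \<le> C}" "u \<longlonglongrightarrow> \<xi>"
      using subsetD[OF sub \<xi>] unfolding closure_sequential by blast
    have "norm (of_real s * \<xi>) < 1"
      using n s t by (simp add: norm_mult)
    then have "isCont b (of_real s * \<xi>)"
      using lim by (simp add: isCont_def)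
    then have "(\<lambda>n. norm (b (of_real s * u n))) \<longlonglongrightarrow> norm (b (of_real s * \<xi>))"
      using u(2) by (intro tendsto_norm isCont_tendsto_compose[of _ b] tendsto_intros)
    moreover have "norm (b (of_real s * u n)) \<le> D" for n
      using u(1)[of n] s t radial[of "u n" s] by auto
    ultimately show "norm (b (of_real s * \<xi>)) \<le> D"
      by (meson LIMSEQ_le_const2)
  qed
  have "connected_component \<Omega> 0 v" if v: "v \<in> \<Omega>" for v
  proof (rule ccontr)
    assume no: "\<not> connected_component \<Omega> 0 v"
    define V where "V = connected_component_set \<Omega> v"
    have V: "open V" "connected V" "V \<subseteq> \<Omega>" "v \<in> V"
      using op v by (auto simp: V_def open_connected_component connected_component_subset)
    have V0: "\<not> connected_component \<Omega> 0 y" if "y \<in> V" for y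
      using that no unfolding V_def by (metis connected_component_sym connected_component_trans mem_Collect_eq)
    have V1: "V \<subseteq> ball 0 1"
      using V(3) by (auto simp: \<Omega>_def)
    have bC: "C < norm (b y)" if "y \<in> V" for y
      using V0[OF that] sub0[of y] V1 that by (meson linorder_not_le mem_ball_0 subsetD)
    then have bnz: "b y \<noteq> 0" if "y \<in> V" for y
      using C(1) that by force
    define E where "E = frontier V \<inter> sphere 0 1"
    have Espec: "\<xi> \<in> spec b" if "\<xi> \<in> E" for \<xi>
    proof (rule in_spec_of_closure[OF _ C(4)])
      show "norm \<xi> = 1"
        using that by (simp add: E_def)
      have "V \<subseteq> {z\<in>ball 0 1. norm (b z) \<le> C'}"
        using V(3) by (auto simp: \<Omega>_def)
      then show "\<xi> \<in> closure {z \<in> ball 0 1. norm (b z) \<le> C'}"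
        using that closure_mono by (auto simp: E_def frontier_def)
    qed
    have "finite E"
    proof (rule finite_radial_accessible_points[OF V(2) V1])
      show "0 \<notin> V"
        using V0 \<open>connected_component \<Omega> 0 0\<close> by blast
      show "E \<subseteq> closure V \<inter> sphere 0 1"
        by (auto simp: E_def frontier_def)
      show "of_real t * \<xi> \<notin> V" if "\<xi> \<in> E" "0 < t" "t < 1" for \<xi> t
        using V0 radii[OF Espec] that by blast
    qed
    \<comment> \<open>Otherwise the open component of \<open>w\<close> would meet \<open>V\<close>,
      hence equal \<open>V\<close>, although the open set \<open>V\<close> contains none of its
      frontier points.\<close>
    have inner: "C' \<le> norm (b w)" if "w \<in> frontier V" "norm w < 1" for w
    proof (rule ccontr)
      assume "\<not> ?thesis"
      then have "w \<in> \<Omega>"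
        using that by (auto simp: \<Omega>_def)
      define W where "W = connected_component_set \<Omega> w"
      have "open W" "w \<in> W"
        using op \<open>w \<in> \<Omega>\<close> by (auto simp: W_def open_connected_component)
      moreover have "w \<in> closure V"
        using that by (simp add: frontier_def)
      ultimately have "W \<inter> V \<noteq> {}"
        using open_Int_closure_eq_empty by blast
      then have "W = V"
        unfolding W_def V_def using connected_component_nonoverlap by blast
      then show False
        using that(1) \<open>w \<in> W\<close> V(1) by (simp add: frontier_def interior_open)
    qed
    \<comment> \<open>\<open>g\<close> vanishes at the exceptional points and has modulus at most 1
      on the closed disc. So \<open>g / b^m\<close> tends to 0 at \<open>E\<close> and obeys the
      bound \<open>1 / C'^m\<close> elsewhere on the frontier; large \<open>m\<close> then removes
      the fixed factor \<open>g v\<close>.\<close>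
    define g where "g z = (\<Prod>\<xi>\<in>E. (\<xi> - z) / 2)" for z
    have gcont: "(g \<longlongrightarrow> g w) (at w within V)" for w
      unfolding g_def by (intro tendsto_intros) auto
    have g1: "norm (g z) \<le> 1" if "norm z \<le> 1" for z
      unfolding g_def prod_norm[symmetric]
    proof (rule prod_le_1)
      fix \<xi> assume "\<xi> \<in> E"
      then show "0 \<le> norm ((\<xi> - z) / 2) \<and> norm ((\<xi> - z) / 2) \<le> 1"
        using norm_triangle_ineq4[of \<xi> z] that by (auto simp: E_def norm_divide)
    qed
    have g0: "g v \<noteq> 0"
      using \<open>finite E\<close> V V1 by (auto simp: g_def E_def)
    have bound: "norm (g v / b v ^ m) \<le> 1 / C' ^ m" for m
    proof (rule maximum_modulus_limsup[of V "\<lambda>z. g z / b z ^ m"])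
      show "bounded V"
        using V1 bounded_ball bounded_subset by blast
      show "(\<lambda>z. g z / b z ^ m) holomorphic_on V"
        unfolding g_def using bnz V1 
        by (intro holomorphic_intros holomorphic_on_subset[OF hol]) auto
      fix w s assume w: "w \<in> frontier V" and s: "s > 1 / C' ^ m"
      have C'0: "C' > 0"
        using C by linarith
      have "closure V \<subseteq> cball 0 1"
        using V1 by (intro closure_minimal) auto
      then have "w \<in> cball 0 1"
        using w by (auto simp: frontier_def)
      then consider "norm w < 1" | "w \<in> E"
        using w by (auto simp: E_def less_le)
      then show "eventually (\<lambda>z. norm (g z / b z ^ m) < s) (at w within V)"
      proof cases
        case 1
        have bw: "C' \<le> norm (b w)"
          using inner[OF w 1] .
        have "norm (g w / b w ^ m) \<le> 1 / C' ^ m"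
          using g1[of w] 1 bw C'0 by (auto simp: norm_divide norm_power intro!: frac_le power_mono)
        then have lt: "norm (g w / b w ^ m) < s"
          using s by linarith
        have "((\<lambda>z. norm (g z / b z ^ m)) \<longlongrightarrow> norm (g w / b w ^ m)) (at w within V)"
          using bw C'0 by (intro tendsto_intros gcont lim 1) auto
        then show ?thesis
          using lt by (rule order_tendstoD(2))
      next
        case 2
        then have "g w = 0"
          using \<open>finite E\<close> by (auto simp: g_def)
        then have "((\<lambda>z. norm (g z) / C ^ m) \<longlongrightarrow> norm (0::complex) / C ^ m) (at w within V)"
          using gcont[of w] C(1) by (intro tendsto_divide tendsto_norm tendsto_const) auto
        moreover have "0 < 1 / C' ^ m"
          using C'0 by simp
        then have "0 < s"
          using s by linarith
        then have "norm (0::complex) / C ^ m < s"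
          by simp
        ultimately have "eventually (\<lambda>z. norm (g z) / C ^ m < s) (at w within V)"
          by (rule order_tendstoD(2))
        moreover have "eventually (\<lambda>z. z \<in> V) (at w within V)"
          by (simp add: eventually_at_filter)
        ultimately show ?thesis
        proof eventually_elim
          case (elim z)
          have "norm (g z / b z ^ m) \<le> norm (g z) / C ^ m"
            using bC[OF elim(2)] C(1) by (auto simp: norm_divide norm_power intro!: frac_le power_mono)
          with elim(1) show ?case
            by linarith
        qed
      qed
    qed (use V in auto)
    have bv: "0 < norm (b v)" "norm (b v) < C'"
      using bnz V(3,4) by (auto simp: \<Omega>_def)
    then obtain m where "1 / norm (g v) < (C' / norm (b v)) ^ m"
      using real_arch_pow[of "C' / norm (b v)"] by auto
    moreover have "(C' / norm (b v)) ^ m \<le> 1 / norm (g v)"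
      using bound[of m] bv g0 by (simp add: norm_divide norm_power power_divide field_simps)
    ultimately show False
      by linarith
  qed
  then show ?thesis
    unfolding \<Omega>_def[symmetric] connected_iff_connected_component
    by (meson connected_component_sym connected_component_trans)
qed

section \<open>Both implications, with constant functions and suprema\<close>

theorem theorem1p3:
  shows "(\<forall>b. one_component b \<longrightarrow>
            (\<exists>K>0. \<forall>a\<in>ball 0 1.
               (SUP z\<in>ball 0 1. norm ((1 - cnj (b a) * b z) / (1 - cnj a * z)))
                 \<le> K * (1 - (norm (b a))\<^sup>2) / (1 - (norm a)\<^sup>2)))
       \<and> (\<forall>b. Hinf_unit b \<longrightarrow>
            (\<exists>C::real. 0 < C \<and> C < 1 \<and> spec b \<subseteq> closure {z\<in>ball 0 1. norm (b z) \<le> C}) \<longrightarrow>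
            (\<forall>\<epsilon>>0. \<exists>\<delta>>0. \<forall>a\<in>ball 0 1. norm (b a) > 1 - \<delta> \<longrightarrow>
               (SUP z\<in>ball 0 1. norm ((1 - cnj (b a) * b z) / (1 - cnj a * z)))
                 \<le> \<epsilon> / (1 - (norm a)\<^sup>2)) \<longrightarrow>
            one_component b)"
proof (intro conjI allI impI)
  fix b assume oc: "one_component b"
  then have H: "Hinf_unit b"
    by (simp add: one_component_def)
  have "\<exists>K>0. \<forall>a z. norm a < 1 \<longrightarrow> norm z < 1 \<longrightarrow>
    norm ((1 - cnj (b a) * b z) / (1 - cnj a * z)) \<le> K * (1 - (norm (b a))\<^sup>2) / (1 - (norm a)\<^sup>2)"
  proof (cases "b constant_on ball 0 1")
    case True
    obtain c where c: "norm c = 1" "\<And>z. norm z < 1 \<Longrightarrow> b z = c"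
      using Hinf_unit_constantD[OF H True] by blast
    then have "cnj c * c = 1"
      using complex_norm_square[of c] by (simp add: mult.commute)
    \<comment> \<open>For a unimodular constant both sides are 0.\<close>
    then show ?thesis
      using c by (intro exI[of _ 1]) auto
  next
    case False
    then show ?thesis
      using oc kernel_bound[OF H False] by (auto simp: one_component_def)
  qed
  then show "\<exists>K>0. \<forall>a\<in>ball 0 1. (SUP z\<in>ball 0 1. norm ((1 - cnj (b a) * b z) / (1 - cnj a * z)))
                 \<le> K * (1 - (norm (b a))\<^sup>2) / (1 - (norm a)\<^sup>2)"
    by (elim exE conjE, intro exI conjI ballI cSUP_least) auto
next
  fix b
  assume H: "Hinf_unit b"
    and "\<exists>C::real. 0 < C \<and> C < 1 \<and> spec b \<subseteq> closure {z\<in>ball 0 1. norm (b z) \<le> C}"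
    and o: "\<forall>\<epsilon>>0. \<exists>\<delta>>0. \<forall>a\<in>ball 0 1. norm (b a) > 1 - \<delta> \<longrightarrow>
               (SUP z\<in>ball 0 1. norm ((1 - cnj (b a) * b z) / (1 - cnj a * z))) \<le> \<epsilon> / (1 - (norm a)\<^sup>2)"
  then obtain C :: real where C: "0 < C" "C < 1" and sub: "spec b \<subseteq> closure {z\<in>ball 0 1. norm (b z) \<le> C}"
    by blast
  show "one_component b"
  proof (cases "b constant_on ball 0 1")
    case True
    obtain c where c: "norm c = 1" "\<And>z. norm z < 1 \<Longrightarrow> b z = c"
      using Hinf_unit_constantD[OF H True] by blast
    then have "{z\<in>ball 0 1. norm (b z) < C} = {}"
      using C by auto
    then have "connected {z\<in>ball 0 1. norm (b z) < C}"
      by (metis connected_empty)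
    then show ?thesis
      unfolding one_component_def using H C sub by blast
  next
    case False
    obtain \<delta> where \<delta>: "\<delta> > 0" "\<And>a. \<lbrakk>norm a < 1; norm (b a) > 1 - \<delta>\<rbrakk> \<Longrightarrow>
        (SUP z\<in>ball 0 1. norm ((1 - cnj (b a) * b z) / (1 - cnj a * z))) \<le> (1 - C) / 2 / (1 - (norm a)\<^sup>2)"
      \<comment> \<open>On a radius ending at \<open>z\<close> with \<open>|b(z)| <= C\<close> the
        kernel at \<open>z\<close> is at least \<open>(1 - C) / (1 - |a|^2)\<close>, twice what this
        choice permits.\<close>
      using o[rule_format, of "(1 - C) / 2"] C by auto
    have le1: "norm (b z) \<le> 1" if "norm z < 1" for z
      using Hinf_unitD(2)[OF H that] .
    have ptw: "norm (1 - cnj (b a) * b z) / norm (1 - cnj a * z) \<le> (1 - C) / 2 / (1 - (norm a)\<^sup>2)"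
      if a: "norm a < 1" "norm (b a) > 1 - \<delta>" and z: "norm z < 1" for a z
    proof -
      \<comment> \<open>A real supremum bounds its terms only for a set bounded above, which this
        estimate provides.\<close>
      have "norm ((1 - cnj (b a) * b z) / (1 - cnj a * z)) \<le> 2 / (1 - norm a)" if "norm z < 1" for z
        unfolding norm_divide
        using one_minus_norm_le(1)[of a z] one_minus_norm_le(3)[OF le1[OF a(1)] le1[OF that]] a that
        by (intro frac_le) auto
      then have "bdd_above ((\<lambda>z. norm ((1 - cnj (b a) * b z) / (1 - cnj a * z))) ` ball 0 1)"
        by (intro bdd_aboveI2) auto
      then have "norm ((1 - cnj (b a) * b z) / (1 - cnj a * z))
          \<le> (SUP z\<in>ball 0 1. norm ((1 - cnj (b a) * b z) / (1 - cnj a * z)))"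
        using z by (intro cSUP_upper) auto
      also have "\<dots> \<le> (1 - C) / 2 / (1 - (norm a)\<^sup>2)"
        by (rule \<delta>(2)[OF a])
      finally show ?thesis
        by (simp only: norm_divide)
    qed
    \<comment> \<open>The midpoint between 1 and the larger of the two levels that have to be
      exceeded.\<close>
    define C' where "C' = (1 + max C (1 - \<delta>)) / 2"
    have C': "C \<le> C'" "1 - \<delta> < C'" "C' < 1"
      using C \<delta> by (auto simp: C'_def)
    have radial: "norm (b (of_real t * z)) \<le> 1 - \<delta>"
      if z: "norm z < 1" "norm (b z) \<le> C" and t: "0 \<le> t" "t \<le> 1" for z t
    proof (rule ccontr)
      define a where "a = of_real t * z"
      assume "\<not> norm (b (of_real t * z)) \<le> 1 - \<delta>"
      then have ba: "norm (b a) > 1 - \<delta>"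
        by (simp add: a_def)
      have na: "norm a = t * norm z"
        using t by (simp add: a_def norm_mult)
      then have a: "norm a \<le> norm z" "norm a < 1"
        using t z mult_left_le_one_le[of "norm z" t] by auto
      have d: "0 < 1 - (norm a)\<^sup>2"
        using a by (simp add: power_less_one_iff)
      have "cnj a * z = of_real (norm a * norm z)"
        using complex_norm_square[of z] by (simp add: na, simp add: a_def power2_eq_square mult_ac)
      then have "norm (1 - cnj a * z) = norm (of_real (1 - norm a * norm z) :: complex)"
        by simp
      also have "\<dots> = 1 - norm a * norm z"
        using mult_le_one[of "norm a" "norm z"] a z by (simp only: norm_of_real) simp
      also have "\<dots> \<le> 1 - (norm a)\<^sup>2"
        using a by (simp add: power2_eq_square mult_left_mono)
      finally have le: "norm (1 - cnj a * z) \<le> 1 - (norm a)\<^sup>2" .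
      have "1 - C \<le> norm (1 - cnj (b a) * b z)"
        using one_minus_norm_le(2)[OF le1[OF a(2)] le1[OF z(1)]] z(2) by linarith
      also have "\<dots> \<le> (1 - C) / 2 / (1 - (norm a)\<^sup>2) * norm (1 - cnj a * z)"
        using ptw[OF a(2) ba z(1)] disc_one_minus_nonzero[OF a(2) z(1)] by (simp add: pos_divide_le_eq)
      also have "\<dots> \<le> (1 - C) / 2 / (1 - (norm a)\<^sup>2) * (1 - (norm a)\<^sup>2)"
        using le d C by (intro mult_left_mono) auto
      also have "\<dots> = (1 - C) / 2"
        using d less_imp_neq[OF d] by (intro nonzero_eq_divide_eq[THEN iffD1]) auto
      finally show False
        using C by simp
    qed
    have "connected {z\<in>ball 0 1. norm (b z) < C'}"
      by (rule connected_sublevel_of_radial[OF H False C(1) C' sub radial])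
    moreover have "closure {z\<in>ball 0 1. norm (b z) \<le> C} \<subseteq> closure {z\<in>ball 0 1. norm (b z) \<le> C'}"
      using C' by (intro closure_mono) auto
    ultimately show ?thesis
      unfolding one_component_def using H C C' sub by (intro conjI exI[of _ C']) auto
  qed
qed

end
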